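(* Assume the Markovian random dynamical system $\Phi$ has a periodic measure $\rho:\mathbb{R}\to\mathcal P(\mathbb{X})$ of period $\tau$ on $(\mathbb{X},\mathcal B(\mathbb{X}))$. Then for any $s\in\mathbb{R}$ the limit $$(\mu_s)_\omega:=\lim_{n\to\infty}\Phi(n\tau+s,\theta(-n\tau-s)\omega)\rho_0$$ exists. Let $\mu_s(dx,d\omega)=(\mu_s)_\omega(dx)\times P(d\omega)$. Then $\mu_s$ is a periodic measure on the product measurable space $(\Omega\times\mathbb{X},\mathcal F\otimes\mathcal B(\mathbb{X}))$ for $\Phi$, and $E(\mu_s)_\cdot=\rho_s$, $s\in\mathbb{R}$.
   Context: $\mathbb{X}$ is a Polish space with Borel $\sigma$-algebra $\mathcal B(\mathbb{X})$; $\mathcal P(\mathbb{X})$ is the set of Borel probability measures; $\mathbb{R}^+=[0,\infty)$. $(\Omega,\mathcal F,P,(\theta(t))_{t\in\mathbb{R}},(\mathcal F_s^t)_{s\le t})$ is a filtered metric dynamical system: $\theta(t)$ is $P$-preserving and measurably invertible with $\theta(-t)=\theta(t)^{-1}$, and $\theta(u)^{-1}\mathcal F_s^t=\mathcal F_{s+u}^{t+u}$. A random dynamical system (cocycle) is a jointly measurable $\Phi:\mathbb{R}^+\times\Omega\times\mathbb{X}\to\mathbb{X}$ with $\Phi(0,\omega)=\mathrm{id}$ and $\Phi(t+s,\omega)=\Phi(t,\theta(s)\omega)\Phi(s,\omega)$ for all $s,t\in\mathbb{R}^+$, almost all $\omega$. It is Markovian if $\Phi(t,\cdot)$ is $\mathcal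 F_0^t$-measurable for every $t\in\mathbb{R}^+$, where $\mathcal F_s^t$ is independent of $\mathcal F_{-\infty}^s:=\bigvee_{r\le s}\mathcal F_r^s$ for $s\le t$. Transition probability: $P(t,x,B)=P(\{\omega:\Phi(t,\omega)x\in B\})$. A map $\rho:\mathbb{R}\to\mathcal P(\mathbb{X})$ is a periodic measure of period $\tau$ on $(\mathbb{X},\mathcal B(\mathbb{X}))$ for $\Phi$ if $\rho_{s+\tau}=\rho_s$ and $\rho_{t+s}(B)=\int_{\mathbb{X}}P(t,x,B)\rho_s(dx)$ for all $s\in\mathbb{R}$, $t\in\mathbb{R}^+$. $\Phi(t,\omega)\rho_0$ denotes the push-forward of $\rho_0$ under $\Phi(t,\omega)$; the limit (over integers $n$ with $n\tau+s\ge0$) is understood for $P$-almost every $\omega$ in the sense of weak convergence of probability measures. $E$ is expectation with respect to $P$, $E(\mu_s)_\cdot(B)=\int_\Omega(\mu_s)_\omega(B)P(d\omega)$. The skew product is $\bar\Theta(t)(\omega,x)=(\theta(t)\omega,\Phi(t,\omega)x)$. A family $\mu_s$, $s\in\mathbb{R}$, of probability measures on $(\Omega\times\mathbb{X},\mathcal F\otimes\mathcal B(\mathbb{X}))$ with marginal $P$ on $\Omega$ is a periodic measure of period $\tau$ for $\Phi$ if $\mu_{\tau+s}=\mu_s$ and $\bar\Theta(t)\mu_s=\mu_{t+s}$ (push-forward) for all $t\in\mathbb{R}^+$, $s\in\mathbb{R}$. *)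

theory Defs
  imports "HOL-Probability.Probability"
begin

text \<open>
  The flow property yields that every \<open>\<theta> t\<close> is measurably invertible on the sample
  space, with inverse \<open>\<theta> (- t)\<close>.
\<close>

locale metric_dynamical_system = prob_space P
  for P :: "'w measure" and \<theta> :: "real \<Rightarrow> 'w \<Rightarrow> 'w" +
  assumes theta_measurable: "\<And>t. \<theta> t \<in> measurable P P"
    and theta_preserving: "\<And>t. distr P P (\<theta> t) = P"
    and theta_0: "\<And>\<omega>. \<omega> \<in> space P \<Longrightarrow> \<theta> 0 \<omega> = \<omega>"
    and theta_add: "\<And>s t \<omega>. \<omega> \<in> space P \<Longrightarrow> \<theta> (s + t) \<omega> = \<theta> s (\<theta> t \<omega>)"

text \<open>
  A sub-\<open>\<sigma>\<close>-algebra is represented by a measure of which only \<open>space\<close> and \<open>sets\<close> matter;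
  \<open>\<F> s t\<close> is constrained for \<open>s \<le> t\<close> only.
\<close>

locale filtered_metric_dynamical_system = metric_dynamical_system P \<theta>
  for P :: "'w measure" and \<theta> :: "real \<Rightarrow> 'w \<Rightarrow> 'w" +
  fixes \<F> :: "real \<Rightarrow> real \<Rightarrow> 'w measure"
  assumes F_subalgebra: "\<And>s t. s \<le> t \<Longrightarrow> subalgebra P (\<F> s t)"
    and F_mono: "\<And>r s t u. r \<le> s \<Longrightarrow> s \<le> t \<Longrightarrow> t \<le> u \<Longrightarrow> sets (\<F> s t) \<subseteq> sets (\<F> r u)"
    and F_shift: "\<And>s t u. s \<le> t \<Longrightarrow>
          (\<lambda>A. \<theta> u -` A \<inter> space P) ` sets (\<F> s t) = sets (\<F> (s + u) (t + u))"

text \<open>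
  The time argument of \<open>\<Phi>\<close> is constrained on \<open>[0, \<infinity>)\<close> only. The exceptional null set in
  the cocycle property may depend on \<open>s\<close> and \<open>t\<close>, but not on the point of the state space.
\<close>

locale random_dynamical_system = metric_dynamical_system P \<theta>
  for P :: "'w measure" and \<theta> :: "real \<Rightarrow> 'w \<Rightarrow> 'w" +
  fixes \<Phi> :: "real \<Rightarrow> 'w \<Rightarrow> 'x::polish_space \<Rightarrow> 'x"
  assumes Phi_measurable: "(\<lambda>(t, \<omega>, x). \<Phi> t \<omega> x)
          \<in> measurable (restrict_space borel {0..} \<Otimes>\<^sub>M (P \<Otimes>\<^sub>M borel)) borel"
    and Phi_0: "AE \<omega> in P. \<forall>x. \<Phi> 0 \<omega> x = x"
    and Phi_cocycle: "\<And>s t. 0 \<le> s \<Longrightarrow> 0 \<le> t \<Longrightarrow>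
          AE \<omega> in P. \<forall>x. \<Phi> (t + s) \<omega> x = \<Phi> t (\<theta> s \<omega>) (\<Phi> s \<omega> x)"

text \<open>
  In \<open>F_indep\<close> the second \<open>\<sigma>\<close>-algebra is the past up to time \<open>s\<close>, generated by all
  \<open>\<F> r s\<close> with \<open>r \<le> s\<close>. That the random map \<open>\<Phi> t\<close> is \<open>\<F> 0 t\<close>-measurable is understood
  jointly in the sample and the state.
\<close>

locale markovian_random_dynamical_system =
  filtered_metric_dynamical_system P \<theta> \<F> + random_dynamical_system P \<theta> \<Phi>
  for P :: "'w measure" and \<theta> :: "real \<Rightarrow> 'w \<Rightarrow> 'w"
    and \<F> :: "real \<Rightarrow> real \<Rightarrow> 'w measure"
    and \<Phi> :: "real \<Rightarrow> 'w \<Rightarrow> 'x::polish_space \<Rightarrow> 'x" +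
  assumes F_indep: "\<And>s t. s \<le> t \<Longrightarrow>
          indep_set (sets (\<F> s t)) (sigma_sets (space P) (\<Union>r\<in>{..s}. sets (\<F> r s)))"
    and Phi_adapted: "\<And>t. 0 \<le> t \<Longrightarrow>
          (\<lambda>(\<omega>, x). \<Phi> t \<omega> x) \<in> measurable (\<F> 0 t \<Otimes>\<^sub>M borel) borel"

definition transition_prob ::
    "'w measure \<Rightarrow> (real \<Rightarrow> 'w \<Rightarrow> 'x \<Rightarrow> 'x) \<Rightarrow> real \<Rightarrow> 'x \<Rightarrow> 'x set \<Rightarrow> real" where
  "transition_prob P \<Phi> t x B = measure P {\<omega> \<in> space P. \<Phi> t \<omega> x \<in> B}"

definition state_periodic_measure ::
    "'w measure \<Rightarrow> (real \<Rightarrow> 'w \<Rightarrow> 'x::polish_space \<Rightarrow> 'x) \<Rightarrow> real \<Rightarrow> (real \<Rightarrow> 'x measure) \<Rightarrow> bool"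
  where
  "state_periodic_measure P \<Phi> \<tau> \<rho> \<longleftrightarrow>
     0 < \<tau> \<and>
     (\<forall>s. \<rho> s \<in> space (prob_algebra borel)) \<and>
     (\<forall>s. \<rho> (s + \<tau>) = \<rho> s) \<and>
     (\<forall>s t. 0 \<le> t \<longrightarrow>
        (\<forall>B\<in>sets borel. measure (\<rho> (t + s)) B = (\<integral>x. transition_prob P \<Phi> t x B \<partial>\<rho> s)))"

definition skew_product ::
    "(real \<Rightarrow> 'w \<Rightarrow> 'w) \<Rightarrow> (real \<Rightarrow> 'w \<Rightarrow> 'x \<Rightarrow> 'x) \<Rightarrow> real \<Rightarrow> 'w \<times> 'x \<Rightarrow> 'w \<times> 'x" where
  "skew_product \<theta> \<Phi> t = (\<lambda>(\<omega>, x). (\<theta> t \<omega>, \<Phi> t \<omega> x))"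

definition product_periodic_measure ::
    "'w measure \<Rightarrow> (real \<Rightarrow> 'w \<Rightarrow> 'w) \<Rightarrow> (real \<Rightarrow> 'w \<Rightarrow> 'x::polish_space \<Rightarrow> 'x) \<Rightarrow> real
       \<Rightarrow> (real \<Rightarrow> ('w \<times> 'x) measure) \<Rightarrow> bool" where
  "product_periodic_measure P \<theta> \<Phi> \<tau> \<mu> \<longleftrightarrow>
     0 < \<tau> \<and>
     (\<forall>s. \<mu> s \<in> space (prob_algebra (P \<Otimes>\<^sub>M borel))) \<and>
     (\<forall>s. distr (\<mu> s) P fst = P) \<and>
     (\<forall>s. \<mu> (\<tau> + s) = \<mu> s) \<and>
     (\<forall>s t. 0 \<le> t \<longrightarrow> distr (\<mu> s) (P \<Otimes>\<^sub>M borel) (skew_product \<theta> \<Phi> t) = \<mu> (t + s))"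

text \<open>Weak convergence of Borel probability measures, tested on bounded continuous functions.\<close>

definition weakly_converges_to ::
    "(nat \<Rightarrow> 'x::topological_space measure) \<Rightarrow> 'x measure \<Rightarrow> bool" where
  "weakly_converges_to M N \<longleftrightarrow>
     (\<forall>f :: 'x \<Rightarrow> real. continuous_on UNIV f \<longrightarrow> bounded (range f) \<longrightarrow>
        (\<lambda>n. \<integral>x. f x \<partial>M n) \<longlonglongrightarrow> (\<integral>x. f x \<partial>N))"

text \<open>
  The push-forward of \<open>\<rho> 0\<close> under \<open>\<Phi> (n\<tau> + s) (\<theta> (- n\<tau> - s) \<omega>)\<close>. For \<open>\<tau> > 0\<close> the time
  \<open>n\<tau> + s\<close> is nonnegative for all large \<open>n\<close>, so that the finitely many terms at
  negative times do not affect the limit.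
\<close>

definition pullback_measure ::
    "(real \<Rightarrow> 'w \<Rightarrow> 'w) \<Rightarrow> (real \<Rightarrow> 'w \<Rightarrow> 'x::polish_space \<Rightarrow> 'x) \<Rightarrow> real
       \<Rightarrow> (real \<Rightarrow> 'x measure) \<Rightarrow> real \<Rightarrow> 'w \<Rightarrow> nat \<Rightarrow> 'x measure" where
  "pullback_measure \<theta> \<Phi> \<tau> \<rho> s \<omega> n =
     distr (\<rho> 0) borel (\<Phi> (real n * \<tau> + s) (\<theta> (- real n * \<tau> - s) \<omega>))"

text \<open>
  The limit only determines \<open>(\<mu>\<^sub>s)\<^sub>\<omega>\<close> for almost every \<open>\<omega>\<close>; a version is a probability kernel
  (defined for every \<open>\<omega>\<close>) that agrees with the limit almost surely.
\<close>

definition pullback_limit_version ::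
    "'w measure \<Rightarrow> (real \<Rightarrow> 'w \<Rightarrow> 'w) \<Rightarrow> (real \<Rightarrow> 'w \<Rightarrow> 'x::polish_space \<Rightarrow> 'x) \<Rightarrow> real
       \<Rightarrow> (real \<Rightarrow> 'x measure) \<Rightarrow> real \<Rightarrow> ('w \<Rightarrow> 'x measure) \<Rightarrow> bool" where
  "pullback_limit_version P \<theta> \<Phi> \<tau> \<rho> s \<kappa> \<longleftrightarrow>
     \<kappa> \<in> measurable P (prob_algebra borel) \<and>
     (AE \<omega> in P. weakly_converges_to (pullback_measure \<theta> \<Phi> \<tau> \<rho> s \<omega>) (\<kappa> \<omega>))"

text \<open>The measure \<open>\<kappa> \<omega> (dx) \<times> P(d\<omega>)\<close> on the product space, for a probability kernel \<open>\<kappa>\<close>.\<close>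

definition kernel_product ::
    "'w measure \<Rightarrow> ('w \<Rightarrow> 'x::topological_space measure) \<Rightarrow> ('w \<times> 'x) measure" where
  "kernel_product P \<kappa> = P \<bind> (\<lambda>\<omega>. distr (\<kappa> \<omega>) (P \<Otimes>\<^sub>M borel) (Pair \<omega>))"

end

theory Submission
  imports Defs
begin

text \<open>
  For a Borel set \<open>B\<close> and times \<open>t\<^sub>n = n\<tau> + s\<close>, the masses \<open>(\<Phi> t\<^sub>n (\<theta> (- t\<^sub>n) \<omega>) \<rho>\<^sub>0) B\<close> form a bounded
  martingale for the filtration \<open>\<F> (- t\<^sub>n) 0\<close>: by the cocycle property, the step from \<open>n\<close> to \<open>n + 1\<close>
  inserts a map that is independent of \<open>\<F> (- t\<^sub>n) 0\<close> and, after averaging, carries \<open>\<rho>\<^sub>0\<close> to \<open>\<rho>\<^sub>\<tau> = \<rho>\<^sub>0\<close>.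
  Hence the masses converge almost surely along a countable algebra generating the Borel sets. Since
  their means are those of \<open>\<rho>\<^sub>s\<close>, inner regularity of \<open>\<rho>\<^sub>s\<close> and Fatou's lemma provide enough tightness
  for the limiting set function to extend to a random measure, which is the weak limit.
  The past-measurable pull-back measures are independent of \<open>\<F> 0 t\<close>, so their masses converge in mean also on
  \<open>\<F> 0 t\<close>-measurable random sets; with the cocycle property this gives invariance under the skew product.
\<close>

subsection \<open>Bounded martingales\<close>

text \<open>Almost sure convergence of the masses comes with an exceptional null set that depends on
  the Borel set, so it can be had at once only for countably many sets. Two consequences shape the
  proof. The limit on a countable algebra is a priori only finitely additive, and no bound valid on
  every path supplies the missing continuity at the empty set; it is available only in the mean,
  through the fixed law \<open>\<rho> t\<close>. And the set tested for invariance varies with the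
  sample point, so it is out of reach of a countable algebra path by path; a statement in mean over
  all measurable random sets takes its place. Bounded masses are square integrable, so the
  martingale theorem is obtained from orthogonality of increments, without counting upcrossings.
  Pull-backs are indexed by their running time \<open>t \<ge> 0\<close>; an arbitrary real
  \<open>s\<close> is reached by adding enough periods, which only drops initial terms of the
  sequence. Since the limit fixes the random measure only up to null sets, the conclusions are
  proved for every choice of measurable versions.\<close>

locale bounded_martingale = prob_space +
  fixes G :: "nat \<Rightarrow> 'a measure" and X :: "nat \<Rightarrow> 'a \<Rightarrow> real" and C :: real
  assumes subalg: "\<And>n. subalgebra M (G n)"
    and mono: "\<And>n. sets (G n) \<subseteq> sets (G (Suc n))"
    and meas: "\<And>n. X n \<in> borel_measurable (G n)"
    and bdd: "\<And>n \<omega>. \<omega> \<in> space M \<Longrightarrow> \<bar>X n \<omega>\<bar> \<le> C"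
    and mart: "\<And>n A. A \<in> sets (G n) \<Longrightarrow> (\<integral>\<omega>\<in>A. X (Suc n) \<omega> \<partial>M) = (\<integral>\<omega>\<in>A. X n \<omega> \<partial>M)"

text \<open>Orthogonality of increments: \<open>X m - X k\<close> integrates to zero against
  anything known at time \<open>k\<close>. The identity on sets says that \<open>X m\<close> is the
  conditional expectation of \<open>X (Suc m)\<close>, and a factor known at time \<open>k\<close>
  is also known at time \<open>m\<close>, so it moves inside the conditional expectation at each
  step.\<close>

lemma (in bounded_martingale) mult_integral:
  assumes Z: "Z \<in> borel_measurable (G k)" and Zbdd: "\<And>\<omega>. \<omega> \<in> space M \<Longrightarrow> \<bar>Z \<omega>\<bar> \<le> D"
    and le: "k \<le> m"
  shows "(\<integral>\<omega>. Z \<omega> * X m \<omega> \<partial>M) = (\<integral>\<omega>. Z \<omega> * X k \<omega> \<partial>M)"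
  using le
proof (induction m rule: dec_induct)
  case (step m)
  interpret S: finite_measure_subalgebra M "G m"
    by unfold_locales (rule subalg)
  have measM: "X n \<in> borel_measurable M" for n
    by (rule measurable_from_subalg[OF subalg meas])
  have int: "integrable M (X n)" for n
    by (rule integrable_const_bound[where B=C]) (use bdd measM in auto)
  have "sets (G k) \<subseteq> sets (G m)"
    by (rule lift_Suc_mono_le[of "\<lambda>n. sets (G n)"]) (use mono step.hyps in auto)
  moreover have "space (G k) = space (G m)"
    using subalg by (auto simp: subalgebra_def)
  ultimately have Zm: "Z \<in> borel_measurable (G m)"
    using Z by (auto simp: measurable_def)
  have ZM: "Z \<in> borel_measurable M"
    by (rule measurable_from_subalg[OF subalg Z])
  have intZ: "integrable M (\<lambda>\<omega>. Z \<omega> * X n \<omega>)" for n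
    by (rule integrable_const_bound[where B="D * C"])
      (use bdd Zbdd ZM measM in \<open>auto simp: abs_mult intro!: mult_mono'\<close>)
  have ce: "AE \<omega> in M. real_cond_exp M (G m) (X (Suc m)) \<omega> = X m \<omega>"
    by (rule S.real_cond_exp_charact[OF mart int int meas])
  have "(\<integral>\<omega>. Z \<omega> * X (Suc m) \<omega> \<partial>M) = (\<integral>\<omega>. Z \<omega> * real_cond_exp M (G m) (X (Suc m)) \<omega> \<partial>M)"
    by (rule S.real_cond_exp_intg(2)[OF intZ Zm measM, symmetric])
  also have "\<dots> = (\<integral>\<omega>. Z \<omega> * X m \<omega> \<partial>M)"
    using ce ZM measM by (intro integral_cong_AE) auto
  finally show ?case using step.IH by simp
qed simp

text \<open>Kolmogorov's argument: decompose by the first time the path has moved by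
  \<open>e\<close> from \<open>X n\<close>. On each piece the later increment is orthogonal to the
  displacement reached so far, so the squared displacement at the final time is on average no
  smaller. The right-hand side is the second moment of that final displacement.\<close>

lemma (in bounded_martingale) maximal_inequality:
  assumes e: "0 < e"
  shows "e\<^sup>2 * prob {\<omega>\<in>space M. \<exists>k\<le>N. e \<le> \<bar>X (n + k) \<omega> - X n \<omega>\<bar>}
    \<le> (\<integral>\<omega>. (X (n + N) \<omega>)\<^sup>2 \<partial>M) - (\<integral>\<omega>. (X n \<omega>)\<^sup>2 \<partial>M)"
proof -
  have measM[measurable]: "X n \<in> borel_measurable M" for n
    by (rule measurable_from_subalg[OF subalg meas])
  define D where "D k \<omega> = X (n + k) \<omega> - X n \<omega>" for k \<omega>
  have sub: "sets (G k) \<subseteq> sets (G m)" if "k \<le> m" for k m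
    by (rule lift_Suc_mono_le[of "\<lambda>n. sets (G n)"]) (use mono that in auto)
  have spG: "space (G k) = space M" for k
    using subalg by (auto simp: subalgebra_def)
  have measG: "X k \<in> borel_measurable (G m)" if "k \<le> m" for k m
    using meas[of k] sub[OF that] spG by (auto simp: measurable_def)
  have C0: "0 \<le> C"
    using bdd not_empty by (metis abs_ge_zero all_not_in_conv order_trans)
  have Dbdd: "\<bar>D k \<omega>\<bar> \<le> 2 * C" if "\<omega> \<in> space M" for k \<omega>
    unfolding D_def using bdd[OF that, of "n + k"] bdd[OF that, of n] by linarith
  have DG: "D j \<in> borel_measurable (G (n + k))" if "j \<le> k" for j k
    unfolding D_def using that by (intro borel_measurable_diff measG) auto
  have DM[measurable]: "D k \<in> borel_measurable M" for k unfolding D_def by measurable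
  \<comment> \<open>First passage exactly at \<open>k\<close>. These events are disjoint, and each
    is decided at time \<open>n + k\<close>, so its indicator times \<open>D k\<close> is an
    admissible factor in \<open>mult_integral\<close>.\<close>
  define A where "A k = {\<omega>\<in>space M. e \<le> \<bar>D k \<omega>\<bar> \<and> (\<forall>j<k. \<bar>D j \<omega>\<bar> < e)}" for k
  have AG: "A k \<in> sets (G (n + k))" for k
  proof -
    have "{\<omega>\<in>space (G (n + k)). e \<le> \<bar>D k \<omega>\<bar> \<and> (\<forall>j\<in>{..<k}. \<bar>D j \<omega>\<bar> < e)} \<in> sets (G (n + k))"
      using DG[of _ k]
      by (intro sets.sets_Collect_conj sets.sets_Collect_finite_All borel_measurable_le borel_measurable_less
          borel_measurable_abs borel_measurable_const) auto
    then show ?thesis by (simp add: A_def spG Ball_def)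
  qed
  have AM[measurable]: "A k \<in> sets M" for k
    using AG subalg by (auto simp: subalgebra_def)
  have intb: "integrable M f" if "f \<in> borel_measurable M" "\<And>\<omega>. \<omega> \<in> space M \<Longrightarrow> \<bar>f \<omega>\<bar> \<le> K" for f :: "'a \<Rightarrow> real" and K
    using that by (intro integrable_const_bound[where B=K]) auto
  have intXX: "integrable M (\<lambda>\<omega>. X i \<omega> * X j \<omega>)" for i j
  proof (rule intb[of _ "C * C"])
    fix \<omega> assume \<omega>: "\<omega> \<in> space M"
    show "\<bar>X i \<omega> * X j \<omega>\<bar> \<le> C * C"
      unfolding abs_mult using C0 by (intro mult_mono bdd \<omega>) auto
  qed measurable
  have intD2: "integrable M (\<lambda>\<omega>. indicator (A k) \<omega> * (D j \<omega>)\<^sup>2)" for j k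
  proof (rule intb[of _ "(2*C)^2"])
    fix \<omega> assume "\<omega> \<in> space M"
    from Dbdd[OF this, of j] have "(D j \<omega>)\<^sup>2 \<le> (2*C)\<^sup>2"
      using abs_le_square_iff C0 by (metis abs_of_nonneg mult_nonneg_nonneg zero_le_numeral)
    then show "\<bar>indicator (A k) \<omega> * (D j \<omega>)\<^sup>2\<bar> \<le> (2*C)\<^sup>2"
      by (auto simp: indicator_def)
  qed measurable
  have key: "e\<^sup>2 * prob (A k) \<le> (\<integral>\<omega>. indicator (A k) \<omega> * (D N \<omega>)\<^sup>2 \<partial>M)" if "k \<le> N" for k
  proof -
    have Z: "(\<lambda>\<omega>. indicator (A k) \<omega> * D k \<omega>) \<in> borel_measurable (G (n + k))"
      using AG DG[of k k] by measurable
    have Zb: "\<bar>indicator (A k) \<omega> * D k \<omega>\<bar> \<le> 2 * C" if "\<omega> \<in> space M" for \<omega>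
      using Dbdd[OF that, of k] C0 by (auto simp: indicator_def)
    have i1: "integrable M (\<lambda>\<omega>. (indicator (A k) \<omega> * D k \<omega>) * X j \<omega>)" for j
    proof (rule intb[of _ "(2*C)*C"])
      fix \<omega> assume \<omega>: "\<omega> \<in> space M"
      show "\<bar>(indicator (A k) \<omega> * D k \<omega>) * X j \<omega>\<bar> \<le> (2*C)*C"
        unfolding abs_mult[of "indicator (A k) \<omega> * D k \<omega>"]
        using C0 by (intro mult_mono Zb bdd \<omega>) auto
    qed measurable
    have 0: "(\<integral>\<omega>. (indicator (A k) \<omega> * D k \<omega>) * (X (n+N) \<omega> - X (n+k) \<omega>) \<partial>M) = 0"
      using mult_integral[OF Z Zb, of "n+N"] that i1 by (simp add: right_diff_distrib)
    have i2: "integrable M (\<lambda>\<omega>. (indicator (A k) \<omega> * D k \<omega>) * (X (n+N) \<omega> - X (n+k) \<omega>))"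
      using i1 by (simp add: right_diff_distrib)
    have "e\<^sup>2 * prob (A k) = (\<integral>\<omega>. indicator (A k) \<omega> * e\<^sup>2 \<partial>M)"
      by simp
    also have "\<dots> \<le> (\<integral>\<omega>. indicator (A k) \<omega> * (D k \<omega>)\<^sup>2 \<partial>M)"
    proof (rule integral_mono)
      show "integrable M (\<lambda>\<omega>. indicator (A k) \<omega> * e\<^sup>2)"
        by (rule intb[of _ "e\<^sup>2"]) (auto simp: indicator_def)
      fix \<omega>
      have "e\<^sup>2 \<le> (D k \<omega>)\<^sup>2" if "\<omega> \<in> A k"
        using that e unfolding A_def by (metis (mono_tags, lifting) abs_le_square_iff abs_of_pos mem_Collect_eq)
      then show "indicator (A k) \<omega> * e\<^sup>2 \<le> indicator (A k) \<omega> * (D k \<omega>)\<^sup>2"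
        by (auto simp: indicator_def)
    qed (rule intD2)
    \<comment> \<open>The inserted cross term has mean zero. With it the integrand is the square of
      \<open>D N\<close> minus the square of the increment after \<open>k\<close>, so the next
      estimate holds pointwise.\<close>
    also have "\<dots> = (\<integral>\<omega>. indicator (A k) \<omega> * (D k \<omega>)\<^sup>2
        + 2 * ((indicator (A k) \<omega> * D k \<omega>) * (X (n+N) \<omega> - X (n+k) \<omega>)) \<partial>M)"
      using 0 i2 intD2[of k k] by simp
    also have "\<dots> \<le> (\<integral>\<omega>. indicator (A k) \<omega> * (D N \<omega>)\<^sup>2 \<partial>M)"
    proof (rule integral_mono)
      fix \<omega>
      have "(D N \<omega>)\<^sup>2 = (D k \<omega>)\<^sup>2 + 2 * (D k \<omega> * (X (n+N) \<omega> - X (n+k) \<omega>)) + (X (n+N) \<omega> - X (n+k) \<omega>)\<^sup>2"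
        unfolding D_def by (simp add: power2_eq_square algebra_simps)
      then show "indicator (A k) \<omega> * (D k \<omega>)\<^sup>2
        + 2 * ((indicator (A k) \<omega> * D k \<omega>) * (X (n+N) \<omega> - X (n+k) \<omega>)) \<le> indicator (A k) \<omega> * (D N \<omega>)\<^sup>2"
        by (auto simp: indicator_def)
    qed (use i2 intD2 in auto)
    finally show ?thesis .
  qed
  have disj: "disjoint_family_on A {..N}"
    unfolding disjoint_family_on_def A_def by (force simp: not_less[symmetric] nat_neq_iff)
  have Un: "{\<omega>\<in>space M. \<exists>k\<le>N. e \<le> \<bar>D k \<omega>\<bar>} = (\<Union>k\<in>{..N}. A k)"
  proof (intro equalityI subsetI)
    fix \<omega> assume "\<omega> \<in> {\<omega>\<in>space M. \<exists>k\<le>N. e \<le> \<bar>D k \<omega>\<bar>}"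
    then obtain k where k: "\<omega> \<in> space M" "k \<le> N" "e \<le> \<bar>D k \<omega>\<bar>" by auto
    define l where "l = (LEAST k. e \<le> \<bar>D k \<omega>\<bar>)"
    have "e \<le> \<bar>D l \<omega>\<bar>" unfolding l_def using k(3) by (rule LeastI)
    moreover have "l \<le> N" using k unfolding l_def by (meson Least_le order_trans)
    moreover have "\<bar>D j \<omega>\<bar> < e" if "j < l" for j
      using not_less_Least[OF that[unfolded l_def]] by simp
    ultimately show "\<omega> \<in> (\<Union>k\<in>{..N}. A k)" using k(1) by (auto simp: A_def)
  qed (auto simp: A_def)
  have "e\<^sup>2 * prob (\<Union>k\<in>{..N}. A k) = (\<Sum>k\<le>N. e\<^sup>2 * prob (A k))"
    using disj by (subst finite_measure_finite_Union) (auto simp: sum_distrib_left)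
  also have "\<dots> \<le> (\<Sum>k\<le>N. \<integral>\<omega>. indicator (A k) \<omega> * (D N \<omega>)\<^sup>2 \<partial>M)"
    by (intro sum_mono key) auto
  also have "\<dots> = (\<integral>\<omega>. (\<Sum>k\<le>N. indicator (A k) \<omega> * (D N \<omega>)\<^sup>2) \<partial>M)"
    using intD2 by (subst Bochner_Integration.integral_sum) auto
  also have "\<dots> = (\<integral>\<omega>. indicator (\<Union>k\<in>{..N}. A k) \<omega> * (D N \<omega>)\<^sup>2 \<partial>M)"
    using disj by (subst indicator_UN_disjoint) (auto simp: sum_distrib_right)
  \<comment> \<open>The square of \<open>D N\<close> is written so that everything beyond the
    difference of squares is \<open>X n\<close> times the increment; \<open>mult_integral\<close>
    with factor \<open>X n\<close> then removes it.\<close>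
  also have "\<dots> \<le> (\<integral>\<omega>. (X (n+N) \<omega>)\<^sup>2 - (X n \<omega>)\<^sup>2 - 2 * (X n \<omega> * X (n+N) \<omega> - X n \<omega> * X n \<omega>) \<partial>M)"
  proof (rule integral_mono')
    show "integrable M (\<lambda>\<omega>. (X (n+N) \<omega>)\<^sup>2 - (X n \<omega>)\<^sup>2 - 2 * (X n \<omega> * X (n+N) \<omega> - X n \<omega> * X n \<omega>))"
      unfolding power2_eq_square
      by (intro Bochner_Integration.integrable_diff integrable_mult_right intXX)
    show "indicator (\<Union>k\<in>{..N}. A k) \<omega> * (D N \<omega>)\<^sup>2
      \<le> (X (n+N) \<omega>)\<^sup>2 - (X n \<omega>)\<^sup>2 - 2 * (X n \<omega> * X (n+N) \<omega> - X n \<omega> * X n \<omega>)" for \<omega>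
    proof -
      have "(X (n+N) \<omega>)\<^sup>2 - (X n \<omega>)\<^sup>2 - 2 * (X n \<omega> * X (n+N) \<omega> - X n \<omega> * X n \<omega>) = (D N \<omega>)\<^sup>2"
        unfolding D_def by (simp add: power2_eq_square algebra_simps)
      then show ?thesis by (auto simp: indicator_def)
    qed
    show "0 \<le> (X (n+N) \<omega>)\<^sup>2 - (X n \<omega>)\<^sup>2 - 2 * (X n \<omega> * X (n+N) \<omega> - X n \<omega> * X n \<omega>)" for \<omega>
    proof -
      have "(X (n+N) \<omega>)\<^sup>2 - (X n \<omega>)\<^sup>2 - 2 * (X n \<omega> * X (n+N) \<omega> - X n \<omega> * X n \<omega>) = (D N \<omega>)\<^sup>2"
        unfolding D_def by (simp add: power2_eq_square algebra_simps)
      then show ?thesis by simp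
    qed
  qed
  also have "\<dots> = (\<integral>\<omega>. (X (n+N) \<omega>)\<^sup>2 \<partial>M) - (\<integral>\<omega>. (X n \<omega>)\<^sup>2 \<partial>M)"
  proof -
    show ?thesis
      using mult_integral[OF meas bdd, of n "n+N"] intXX by (simp add: power2_eq_square)
  qed
  finally show ?thesis
    using Un by (simp add: D_def)
qed

text \<open>The second moments increase and are bounded by the square of \<open>C\<close>. Their
  remaining growth after \<open>n\<close> bounds the probability of ever moving by \<open>e\<close>
  after \<open>n\<close>, so for every \<open>e\<close> almost every path settles to within
  \<open>e\<close> from some index on, and is Cauchy.\<close>

lemma (in bounded_martingale) AE_convergent:
  shows "AE \<omega> in M. convergent (\<lambda>n. X n \<omega>)"
proof -
  have measM[measurable]: "X n \<in> borel_measurable M" for n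
    by (rule measurable_from_subalg[OF subalg meas])
  define a where "a n = (\<integral>\<omega>. (X n \<omega>)\<^sup>2 \<partial>M)" for n
  define B where "B e n = {\<omega>\<in>space M. \<exists>k. e \<le> \<bar>X (n + k) \<omega> - X n \<omega>\<bar>}" for e n
  define B' where "B' e n N = {\<omega>\<in>space M. \<exists>k\<le>N. e \<le> \<bar>X (n + k) \<omega> - X n \<omega>\<bar>}" for e n N
  have BM[measurable]: "B e n \<in> sets M" for e n unfolding B_def by measurable
  have max: "e\<^sup>2 * prob (B' e n N) \<le> a (n + N) - a n" if "0 < e" for e n N
    unfolding a_def B'_def by (rule maximal_inequality[OF that])
  have a_le: "a n \<le> C\<^sup>2" for n
  proof -
    have le: "(X n \<omega>)\<^sup>2 \<le> C\<^sup>2" if "\<omega> \<in> space M" for \<omega>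
      using bdd[OF that, of n] by (metis abs_ge_zero power2_abs power_mono)
    have "a n \<le> (\<integral>\<omega>. C\<^sup>2 \<partial>M)"
      unfolding a_def
      by (intro integral_mono integrable_const_bound[where B="C\<^sup>2"]) (use le in auto)
    then show ?thesis by (simp add: prob_space)
  qed
  have "incseq a"
  proof (rule incseq_SucI)
    fix n
    \<comment> \<open>Monotonicity of \<open>a\<close> is read off the maximal inequality with
      threshold 1 and one step: its left side is nonnegative.\<close>
    have "0 \<le> (1::real)\<^sup>2 * prob (B' 1 n 1)" by simp
    also have "\<dots> \<le> a (n + 1) - a n" by (rule max) simp
    finally show "a n \<le> a (Suc n)" by simp
  qed
  then obtain L where L: "a \<longlonglongrightarrow> L" "\<And>n. a n \<le> L"
    using incseq_convergent[of a "C\<^sup>2"] a_le by auto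
  have Bp: "e\<^sup>2 * prob (B e n) \<le> L - a n" if e: "0 < e" for e n
  proof -
    have "(\<lambda>N. prob (B' e n N)) \<longlonglongrightarrow> prob (\<Union>N. B' e n N)"
    proof (rule finite_Lim_measure_incseq)
      show "incseq (B' e n)"
        unfolding incseq_def B'_def using order_trans by blast
    qed (auto simp: B'_def)
    moreover have "(\<Union>N. B' e n N) = B e n" by (auto simp: B_def B'_def)
    ultimately have "(\<lambda>N. e\<^sup>2 * prob (B' e n N)) \<longlonglongrightarrow> e\<^sup>2 * prob (B e n)"
      by (auto intro!: tendsto_intros)
    then show ?thesis
    proof (rule LIMSEQ_le_const2)
      show "\<exists>K. \<forall>N\<ge>K. e\<^sup>2 * prob (B' e n N) \<le> L - a n"
      proof (intro exI allI impI)
        fix N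
        show "e\<^sup>2 * prob (B' e n N) \<le> L - a n"
          using max[OF e, of n N] L(2)[of "n + N"] by linarith
      qed
    qed
  qed
  have null: "AE \<omega> in M. \<exists>n. \<omega> \<notin> B e n" if e: "0 < e" for e
  proof -
    have "prob (\<Inter>n. B e n) \<le> 0"
    proof (rule LIMSEQ_le_const)
      show "(\<lambda>n. (L - a n) / e\<^sup>2) \<longlonglongrightarrow> 0"
        using L(1) e by (auto intro!: tendsto_eq_intros)
      have "prob (\<Inter>n. B e n) \<le> (L - a n) / e\<^sup>2" for n
      proof -
        have "prob (\<Inter>n. B e n) \<le> prob (B e n)" by (intro finite_measure_mono) auto
        also have "\<dots> \<le> (L - a n) / e\<^sup>2" using Bp[OF e, of n] e by (simp add: field_simps)
        finally show ?thesis .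
      qed
      then show "\<exists>N. \<forall>n\<ge>N. prob (\<Inter>n. B e n) \<le> (L - a n) / e\<^sup>2" by auto
    qed
    then have "prob (\<Inter>n. B e n) = 0" by (simp add: measure_le_0_iff)
    then have "(\<Inter>n. B e n) \<in> null_sets M" by (auto simp: emeasure_eq_measure null_sets_def)
    then show ?thesis by (rule AE_I') auto
  qed
  have "AE \<omega> in M. \<forall>j. \<exists>n. \<omega> \<notin> B (1 / Suc j) n"
    unfolding AE_all_countable by (auto intro: null)
  then show ?thesis
  proof (rule AE_mp, intro AE_I2 impI)
    fix \<omega> assume \<omega>: "\<omega> \<in> space M" and *: "\<forall>j. \<exists>n. \<omega> \<notin> B (1 / Suc j) n"
    have "Cauchy (\<lambda>n. X n \<omega>)"
    proof (rule metric_CauchyI)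
      fix e :: real assume "0 < e"
      then obtain j where j: "1 / Suc j < e / 2"
        using nat_approx_posE[of "e/2"] by auto
      obtain n where n: "\<omega> \<notin> B (1 / Suc j) n" using * by blast
      have near: "\<bar>X m \<omega> - X n \<omega>\<bar> < e / 2" if "n \<le> m" for m
      proof -
        have "\<bar>X (n + (m - n)) \<omega> - X n \<omega>\<bar> < 1 / Suc j"
          using n \<omega> unfolding B_def by (auto simp: not_le)
        then show ?thesis using that j by simp
      qed
      show "\<exists>N. \<forall>m\<ge>N. \<forall>n\<ge>N. dist (X m \<omega>) (X n \<omega>) < e"
      proof (intro exI allI impI)
        fix m m' assume "n \<le> m" "n \<le> m'"
        then show "dist (X m \<omega>) (X m' \<omega>) < e"
          unfolding dist_real_def using near[of m] near[of m'] by linarith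
      qed
    qed
    then show "convergent (\<lambda>n. X n \<omega>)" by (simp add: Cauchy_convergent_iff)
  qed
qed

subsection \<open>Weak convergence and limits of measures\<close>

lemma prob_algebraD:
  assumes "\<mu> \<in> space (prob_algebra N)"
  shows "prob_space \<mu>" "sets \<mu> = sets N" "space \<mu> = space N"
  using assms sets_eq_imp_space_eq[of \<mu> N] by (auto simp: space_prob_algebra)

lemma inner_regular_compact:
  fixes M :: "'a::polish_space measure"
  assumes M: "M \<in> space (prob_algebra borel)" and A: "A \<in> sets borel" and e: "0 < e"
  obtains K where "compact K" "K \<subseteq> A" "measure M (A - K) < e"
proof -
  note M = prob_algebraD[OF M]
  interpret prob_space M by (rule M)
  have "\<exists>K. K \<subseteq> A \<and> compact K \<and> measure M A - e < measure M K"
  \<comment> \<open>\<open>ennreal\<close> sends negative numbers to 0, so a negative threshold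
    would not give a strict inequality for null sets; there the empty compact set serves.\<close>
  proof (cases "measure M A - e < 0")
    case True
    then show ?thesis by (intro exI[of _ "{}"]) auto
  next
    case False
    have "ennreal (measure M A - e) < emeasure M A"
      unfolding emeasure_eq_measure using e False by (intro ennreal_lessI) auto
    also have "emeasure M A = (SUP K \<in> {K. K \<subseteq> A \<and> compact K}. emeasure M K)"
      by (rule inner_regular[OF M(2) _ A]) simp
    finally obtain K where K: "K \<subseteq> A" "compact K" "ennreal (measure M A - e) < emeasure M K"
      by (auto simp: less_SUP_iff)
    then have "measure M A - e < measure M K"
      using False unfolding emeasure_eq_measure by (simp add: ennreal_less_iff)
    then show ?thesis using K by blast
  qed
  then obtain K where K: "K \<subseteq> A" "compact K" "measure M A - e < measure M K" by blast
  have "measure M (A - K) = measure M A - measure M K"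
    using K A M(2) by (intro finite_measure_Diff) (auto intro: borel_closed compact_imp_closed)
  then show ?thesis using K by (intro that[of K]) auto
qed

text \<open>Boolean expressions over a countable base: a countable index type for the algebra that the base generates.\<close>

datatype set_code = Base nat | Neg set_code | Or set_code set_code

instance set_code :: countable
  by countable_datatype

primrec code_set :: "(nat \<Rightarrow> 'a set) \<Rightarrow> set_code \<Rightarrow> 'a set" where
  "code_set U (Base n) = U n"
| "code_set U (Neg c) = - code_set U c"
| "code_set U (Or c d) = code_set U c \<union> code_set U d"

lemma algebra_code_set: "algebra UNIV (range (code_set U))"
  unfolding algebra_iff_Un
proof (intro conjI ballI)
  show "{} \<in> range (code_set U)"
    by (rule range_eqI[of _ _ "Neg (Or (Base 0) (Neg (Base 0)))"]) simp
  show "UNIV - A \<in> range (code_set U)" if "A \<in> range (code_set U)" for A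
  proof -
    obtain c where "A = code_set U c" using \<open>A \<in> _\<close> by blast
    then have "UNIV - A = code_set U (Neg c)" by auto
    then show ?thesis by (rule range_eqI)
  qed
  show "A \<union> B \<in> range (code_set U)" if AB: "A \<in> range (code_set U)" "B \<in> range (code_set U)" for A B
  proof -
    obtain c d where "A = code_set U c" "B = code_set U d" using AB by blast
    then have "A \<union> B = code_set U (Or c d)" by simp
    then show ?thesis by (rule range_eqI)
  qed
qed auto

text \<open>Countability collects the null sets and the generating property determines measures. The
  last clause bridges to weak convergence: open sets are exhausted from inside by members of the
  algebra, which is what a lower bound on open sets needs.\<close>

lemma countable_generating_algebra:
  obtains \<A> :: "'a::second_countable_topology set set"
  where "countable \<A>" "algebra UNIV \<A>" "sets borel = sigma_sets UNIV \<A>"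
    "\<And>W. open W \<Longrightarrow> \<exists>I. range I \<subseteq> \<A> \<and> incseq I \<and> W = (\<Union>n::nat. I n)"
proof -
  obtain B :: "'a set set" where B: "countable B" "topological_basis B"
    using ex_countable_basis by blast
  define U where "U = from_nat_into (insert {} B)"
  have rU: "range U = insert {} B"
    unfolding U_def using B(1) by (intro range_from_nat_into) auto
  define \<A> where "\<A> = range (code_set U)"
  interpret algebra UNIV \<A> unfolding \<A>_def by (rule algebra_code_set)
  have UA: "range U \<subseteq> \<A>"
    unfolding \<A>_def by (metis code_set.simps(1) image_subsetI rangeI)
  have borelU: "U n \<in> sets borel" for n
    using rU B(2) by (metis borel_open insertE open_empty rangeI topological_basis_open)
  have "code_set U c \<in> sets borel" for c
    by (induction c) (auto intro: borelU)
  then have "\<A> \<subseteq> sets borel" unfolding \<A>_def by auto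
  then have sub: "sigma_sets UNIV \<A> \<subseteq> sets borel"
    using sets.sigma_sets_subset[of \<A> borel] by simp
  have "sets borel = sigma_sets UNIV B"
    by (subst borel_eq_countable_basis[OF B]) simp
  also have "\<dots> \<subseteq> sigma_sets UNIV \<A>"
    using UA rU by (intro sigma_sets_mono') auto
  finally have "sets borel = sigma_sets UNIV \<A>" using sub by auto
  moreover have "\<exists>I. range I \<subseteq> \<A> \<and> incseq I \<and> W = (\<Union>n::nat. I n)" if "open W" for W
  proof -
    have "\<exists>B'\<subseteq>B. \<Union>B' = W"
      using B(2) that by (simp add: topological_basis_def)
    then obtain B' where B': "B' \<subseteq> B" "\<Union>B' = W" by blast
    \<comment> \<open>When \<open>W\<close> is empty, \<open>B'\<close> may be empty as well; adding
      the empty set keeps the collection nonempty, so that the enumeration has exactly it as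
      range.\<close>
    define V where "V = from_nat_into (insert {} B')"
    have rV: "range V = insert {} B'"
      unfolding V_def using countable_subset[OF B'(1) B(1)] by (intro range_from_nat_into) auto
    have "range V \<subseteq> \<A>"
      unfolding rV using B'(1) UA rU by auto
    then have "V i \<in> \<A>" for i by auto
    then have "range (\<lambda>n. \<Union>i\<le>n. V i) \<subseteq> \<A>" by (auto intro!: finite_UN)
    moreover have "incseq (\<lambda>n. \<Union>i\<le>n. V i)" by (force simp: incseq_def)
    moreover have "W = (\<Union>n. \<Union>i\<le>n. V i)"
    proof -
      have "W = (\<Union>i. V i)" unfolding rV using B'(2) by simp
      also have "\<dots> = (\<Union>n. \<Union>i\<le>n. V i)" by auto
      finally show ?thesis .
    qed
    ultimately show ?thesis by blast
  qed
  moreover have "countable \<A>" unfolding \<A>_def by simp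
  ultimately show ?thesis using that algebra_axioms by blast
qed

text \<open>Bounded continuous functions determine a finite Borel measure on a metric space, because
  they increase to the indicators of open sets, and these form a generator stable under
  intersection. It identifies any version of the limit with the constructed one.\<close>

lemma weakly_converges_to_unique:
  fixes N N' :: "'a::metric_space measure"
  assumes "weakly_converges_to M N" "weakly_converges_to M N'"
    and N: "finite_measure N" "sets N = sets borel" and N': "finite_measure N'" "sets N' = sets borel"
  shows "N = N'"
proof -
  interpret N: finite_measure N by fact
  interpret N': finite_measure N' by fact
  have eq: "(\<integral>x. f x \<partial>N) = (\<integral>x. f x \<partial>N')" if "continuous_on UNIV f" "bounded (range f)" for f :: "'a \<Rightarrow> real"
    using assms(1,2) that unfolding weakly_converges_to_def by (blast intro: LIMSEQ_unique)
  \<comment> \<open>Lipschitz functions increasing to the indicator of \<open>W\<close>. As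
    \<open>infdist\<close> to the empty set is 0 by convention, they fail for
    \<open>W = UNIV\<close>, which is treated apart with the constant function 1.\<close>
  define f where "f W n x = min 1 (real n * infdist x (- W))" for W :: "'a set" and n x
  have f_cont: "continuous_on UNIV (f W n)" for W n
    unfolding f_def by (intro continuous_intros)
  have f_bnd: "\<bar>f W n x\<bar> \<le> 1" for W n x
    by (simp add: f_def infdist_nonneg)
  have f_lim: "(\<lambda>n. f W n x) \<longlonglongrightarrow> indicator W x" if W: "open W" "W \<noteq> UNIV" for W x
  proof (cases "x \<in> W")
    case False
    then have "f W n x = 0" for n unfolding f_def by simp
    then show ?thesis using False by simp
  next
    case True
    have "infdist x (- W) \<noteq> 0"
      using in_closed_iff_infdist_zero[of "- W" x] W True by auto
    then have pos: "0 < infdist x (- W)"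
      using infdist_nonneg[of x "- W"] by linarith
    obtain k :: nat where k: "1 < real k * infdist x (- W)"
      using reals_Archimedean3[OF pos] by blast
    have "f W n x = 1" if "k \<le> n" for n
    proof -
      have "real k * infdist x (- W) \<le> real n * infdist x (- W)"
        using that pos by (intro mult_right_mono) auto
      then show ?thesis using k by (simp add: f_def)
    qed
    then have "\<forall>\<^sub>F n in sequentially. f W n x = indicator W x"
      using True by (auto simp: eventually_sequentially)
    then show ?thesis by (rule tendsto_eventually)
  qed
  have open_eq: "measure N W = measure N' W" if W: "open W" for W
  proof (cases "W = UNIV")
    case True
    then show ?thesis
      using eq[of "\<lambda>_. 1"] sets_eq_imp_space_eq[OF N(2)] sets_eq_imp_space_eq[OF N'(2)] by simp
  next
    case False
    have lim: "(\<lambda>n. \<integral>x. f W n x \<partial>L) \<longlonglongrightarrow> measure L W" if L: "finite_measure L" "sets L = sets borel" for L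
    proof -
      interpret L: finite_measure L by fact
      have "(\<lambda>n. \<integral>x. f W n x \<partial>L) \<longlonglongrightarrow> (\<integral>x. indicator W x \<partial>L)"
      proof (rule integral_dominated_convergence[where w="\<lambda>_. 1"])
        show "f W n \<in> borel_measurable L" for n
          using borel_measurable_continuous_onI[OF f_cont] L(2) by (simp cong: measurable_cong_sets)
        show "indicator W \<in> borel_measurable L" using W L(2) by (intro borel_measurable_indicator) auto
      qed (use f_lim[OF W False] f_bnd in auto)
      moreover have "W \<inter> space L = W" using sets_eq_imp_space_eq[OF L(2)] by simp
      ultimately show ?thesis by simp
    qed
    have "bounded (range (f W n))" for n
      using f_bnd by (auto simp: bounded_iff)
    then have "(\<integral>x. f W n x \<partial>N) = (\<integral>x. f W n x \<partial>N')" for n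
      by (intro eq f_cont)
    then show ?thesis
      using lim[OF N] lim[OF N'] by (simp add: LIMSEQ_unique)
  qed
  show ?thesis
  proof (rule measure_eqI_generator_eq[where E="{W. open W}" and \<Omega>=UNIV and A="\<lambda>_. UNIV"])
    show "sets N = sigma_sets UNIV {W. open W}" "sets N' = sigma_sets UNIV {W. open W}"
      using N(2) N'(2) by (simp_all add: borel_def)
    show "emeasure N X = emeasure N' X" if "X \<in> {W. open W}" for X
      using open_eq that by (simp add: N.emeasure_eq_measure N'.emeasure_eq_measure)
  qed (auto simp: Int_stable_def)
qed

text \<open>One direction of the portmanteau theorem. A function with values in
  \<open>[0, 1)\<close> is, up to \<open>1 / m\<close>, the average of the indicators of its open
  superlevel sets, so lower bounds on open sets pass to its integral. Upper bounds follow by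
  applying this to the negated function.\<close>

lemma weakly_converges_to_if_open_liminf:
  fixes N :: "'a::topological_space measure"
  assumes M: "\<And>n. M n \<in> space (prob_algebra borel)" and N: "N \<in> space (prob_algebra borel)"
    and low: "\<And>W e. open W \<Longrightarrow> 0 < e \<Longrightarrow> \<forall>\<^sub>F n in sequentially. measure N W - e < measure (M n) W"
  shows "weakly_converges_to M N"
proof -
  have P: "prob_space L" "sets L = sets borel" "space L = UNIV" if "L \<in> space (prob_algebra borel)" for L :: "'a measure"
    using that sets_eq_imp_space_eq[of L borel] by (auto simp: space_prob_algebra)
  have half: "\<forall>\<^sub>F n in sequentially. (\<integral>x. f x \<partial>N) - e < (\<integral>x. f x \<partial>M n)"
    if f: "continuous_on UNIV f" "\<And>x. 0 \<le> f x" "\<And>x. f x < 1" and e: "0 < e" for f :: "'a \<Rightarrow> real" and e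
  proof -
    \<comment> \<open>One half of \<open>e\<close> pays for the discretisation into \<open>m\<close>
      levels, the other for the loss of mass on the level sets.\<close>
    obtain k where k: "1 / real (Suc k) < e / 2" using nat_approx_posE[of "e/2"] e by auto
    define m where "m = Suc k"
    have m: "0 < m" "1 / real m < e / 2" using k by (auto simp: m_def)
    define W where "W i = {x. real i / real m < f x}" for i :: nat
    have W: "open (W i)" for i
      unfolding W_def using f(1) by (intro open_Collect_less) (auto intro!: continuous_intros)
    define g where "g x = (\<Sum>i=1..m. indicator (W i) x / real m)" for x
    have g: "g x \<le> f x" "f x \<le> g x + 1 / real m" for x
    proof -
      \<comment> \<open>The number of levels \<open>i / m\<close> with \<open>i \<ge> 1\<close>
        strictly below \<open>f x\<close>. Strictness accounts for the ceiling minus one, and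
        \<open>nat\<close> turns the value -1 at \<open>f x = 0\<close> into 0.\<close>
      define j where "j = nat (ceiling (real m * f x) - 1)"
      have "real m * f x \<le> real m" using f(3)[of x] m by (simp add: mult_left_le)
      have set: "{i\<in>{1..m}. real i < real m * f x} = {1..j}"
      proof (intro equalityI subsetI; clarsimp)
        fix i assume "Suc 0 \<le> i" "real i < real m * f x"
        then have "int i < ceiling (real m * f x)" by (simp add: less_ceiling_iff)
        then show "i \<le> j" unfolding j_def by simp
      next
        fix i assume i: "Suc 0 \<le> i" "i \<le> j"
        then have "int i < ceiling (real m * f x)" unfolding j_def by simp
        then have "real i < real m * f x" by (simp add: less_ceiling_iff)
        then show "i \<le> m \<and> real i < real m * f x"
          using \<open>real m * f x \<le> real m\<close> by simp
      qed
      have "g x = (\<Sum>i\<in>{1..m}. if real i < real m * f x then 1 / real m else 0)"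
        unfolding g_def W_def using m by (intro sum.cong) (auto simp: indicator_def field_simps)
      also have "\<dots> = real j / real m"
        by (subst sum.inter_filter[symmetric]) (simp_all only: set, auto)
      finally have gx: "g x = real j / real m" .
      have "0 \<le> real m * f x" using f(2)[of x] by simp
      then have "real j \<le> real m * f x" "real m * f x \<le> real j + 1"
        unfolding j_def by linarith+
      then show "g x \<le> f x" "f x \<le> g x + 1 / real m"
        using m unfolding gx by (auto simp: field_simps)
    qed
    have gint: "(\<integral>x. g x \<partial>L) = (\<Sum>i=1..m. measure L (W i) / real m)"
        "integrable L g" "integrable L f" if "L \<in> space (prob_algebra borel)" for L
    proof -
      interpret prob_space L using P that by blast
      have [measurable]: "W i \<in> sets L" for i using W P that by auto
      have i: "integrable L (\<lambda>x. indicator (W i) x / real m)" for i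
        by (intro integrable_divide integrable_real_indicator) (auto simp: less_top[symmetric])
      show "(\<integral>x. g x \<partial>L) = (\<Sum>i=1..m. measure L (W i) / real m)" "integrable L g"
        unfolding g_def using i P(3)[OF that] by (auto simp: Bochner_Integration.integral_sum)
      have "f \<in> borel_measurable L"
        using borel_measurable_continuous_onI[OF f(1)] P(2)[OF that] by (simp cong: measurable_cong_sets)
      then show "integrable L f"
        by (intro integrable_const_bound[where B=1]) (use f in \<open>auto simp: less_imp_le\<close>)
    qed
    have "\<forall>\<^sub>F n in sequentially. \<forall>i\<in>{1..m}. measure N (W i) - e / 2 < measure (M n) (W i)"
      using low[OF W, of "e/2"] e by (intro eventually_ball_finite) auto
    then show ?thesis
    proof (rule eventually_mono)
      fix n assume n: "\<forall>i\<in>{1..m}. measure N (W i) - e / 2 < measure (M n) (W i)"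
      interpret N: prob_space N using P N by blast
      have "(\<integral>x. f x \<partial>N) \<le> (\<integral>x. g x + 1 / real m \<partial>N)"
        by (intro integral_mono gint N Bochner_Integration.integrable_add g) auto
      also have "\<dots> = (\<integral>x. g x \<partial>N) + 1 / real m"
        using gint(2)[OF N] by (simp add: N.prob_space)
      also have "\<dots> < (\<integral>x. g x \<partial>N) + e / 2" using m by simp
      also have "(\<integral>x. g x \<partial>N) \<le> (\<Sum>i=1..m. (measure (M n) (W i) + e / 2) / real m)"
        unfolding gint(1)[OF N] using n m by (intro sum_mono divide_right_mono) (auto intro: less_imp_le simp: diff_less_eq)
      also have "\<dots> = (\<integral>x. g x \<partial>M n) + e / 2"
        unfolding gint(1)[OF M] using m by (simp add: add_divide_distrib sum.distrib)
      also have "(\<integral>x. g x \<partial>M n) \<le> (\<integral>x. f x \<partial>M n)"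
        by (intro integral_mono gint M g)
      finally show "(\<integral>x. f x \<partial>N) - e < (\<integral>x. f x \<partial>M n)" by simp
    qed
  qed
  show ?thesis
    unfolding weakly_converges_to_def
  proof (intro allI impI)
    fix f :: "'a \<Rightarrow> real" assume f: "continuous_on UNIV f" "bounded (range f)"
    obtain C where C: "0 < C" "\<And>x. \<bar>f x\<bar> < C"
      using f(2) unfolding bounded_pos_less by auto
    have int: "integrable L f" if "L \<in> space (prob_algebra borel)" for L
    proof -
      interpret prob_space L using P that by blast
      have "f \<in> borel_measurable L"
        using borel_measurable_continuous_onI[OF f(1)] P(2)[OF that] by (simp cong: measurable_cong_sets)
      then show ?thesis
        by (intro integrable_const_bound[where B=C]) (use C in \<open>auto simp: less_imp_le\<close>)
    qed
    have one: "\<forall>\<^sub>F n in sequentially. s * (\<integral>x. f x \<partial>N) - e < s * (\<integral>x. f x \<partial>M n)" if s: "s \<in> {-1, 1}" and e: "0 < e" for s e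
    proof -
      \<comment> \<open>An affine change carries \<open>s * f\<close>, with values between
        \<open>- C\<close> and \<open>C\<close>, into the unit interval required by
        \<open>half\<close>; the two signs \<open>s\<close> give the two one-sided bounds.\<close>
      define h where "h x = (s * f x + C) / (2 * C)" for x
      have hi: "(\<integral>x. h x \<partial>L) = (s * (\<integral>x. f x \<partial>L) + C) / (2 * C)" if "L \<in> space (prob_algebra borel)" for L
      proof -
        interpret prob_space L using P that by blast
        show ?thesis unfolding h_def using int[OF that] by (simp add: prob_space)
      qed
      have "\<forall>\<^sub>F n in sequentially. (\<integral>x. h x \<partial>N) - e / (2 * C) < (\<integral>x. h x \<partial>M n)"
      proof (rule half)
        show "continuous_on UNIV h" unfolding h_def using f(1) C(1) by (intro continuous_intros) auto
        show "0 \<le> h x" "h x < 1" for x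
          using C(1) C(2)[of x] s unfolding h_def by (auto simp: field_simps)
      qed (use e C(1) in simp)
      then show ?thesis
      proof (rule eventually_mono)
        fix n assume "(\<integral>x. h x \<partial>N) - e / (2 * C) < (\<integral>x. h x \<partial>M n)"
        then show "s * (\<integral>x. f x \<partial>N) - e < s * (\<integral>x. f x \<partial>M n)"
          unfolding hi[OF N] hi[OF M] using C(1)
            by (simp add: diff_divide_distrib[symmetric] divide_less_cancel)
      qed
    qed
    show "(\<lambda>n. \<integral>x. f x \<partial>M n) \<longlonglongrightarrow> (\<integral>x. f x \<partial>N)"
    proof (rule tendstoI)
      fix e :: real assume "0 < e"
      show "\<forall>\<^sub>F n in sequentially. dist (\<integral>x. f x \<partial>M n) (\<integral>x. f x \<partial>N) < e"
        using one[of 1, OF _ \<open>0 < e\<close>, simplified] one[of "-1", OF _ \<open>0 < e\<close>, simplified]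
        by eventually_elim (simp add: dist_real_def abs_less_iff)
    qed
  qed
qed

text \<open>
  The limit is additive on \<open>\<A>\<close>; continuity at the empty set is the compact class argument:
  if \<open>A i\<close> decreases to the empty set and the compact \<open>K i \<subseteq> A i\<close> lose little mass, then finitely
  many of the \<open>K i\<close> already have empty intersection.
\<close>

lemma limit_measure_exists:
  fixes \<nu> :: "nat \<Rightarrow> 'a::t2_space measure"
  assumes alg: "algebra UNIV \<A>" and gen: "sets borel = sigma_sets UNIV \<A>"
    and \<nu>: "\<And>n. \<nu> n \<in> space (prob_algebra borel)"
    and conv: "\<And>A. A \<in> \<A> \<Longrightarrow> convergent (\<lambda>n. measure (\<nu> n) A)"
    and tight: "\<And>A e. A \<in> \<A> \<Longrightarrow> 0 < e \<Longrightarrow>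
      \<exists>K. compact K \<and> K \<subseteq> A \<and> (\<forall>\<^sub>F n in sequentially. measure (\<nu> n) (A - K) < e)"
  shows "\<exists>\<kappa>\<in>space (prob_algebra borel). \<forall>A\<in>\<A>. (\<lambda>n. measure (\<nu> n) A) \<longlonglongrightarrow> measure \<kappa> A"
proof -
  interpret \<A>: algebra UNIV \<A> by fact
  have P: "prob_space (\<nu> n)" "sets (\<nu> n) = sets borel" "space (\<nu> n) = UNIV" for n
    using \<nu>[of n] sets_eq_imp_space_eq[of "\<nu> n" borel] by (auto simp: space_prob_algebra)
  interpret \<nu>: prob_space "\<nu> n" for n by (rule P)
  have AB: "A \<in> sets borel" if "A \<in> \<A>" for A
    using that gen by auto
  define L where "L A = lim (\<lambda>n. measure (\<nu> n) A)" for A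
  have L: "(\<lambda>n. measure (\<nu> n) A) \<longlonglongrightarrow> L A" if "A \<in> \<A>" for A
    using conv[OF that] unfolding L_def by (simp add: convergent_LIMSEQ_iff)
  have L0: "0 \<le> L A" if "A \<in> \<A>" for A
    by (rule LIMSEQ_le_const[OF L[OF that]]) auto
  have Lmono: "L A \<le> L B" if "A \<in> \<A>" "B \<in> \<A>" "A \<subseteq> B" for A B
    by (rule LIMSEQ_le[OF L L]) (use that P AB in \<open>auto intro!: \<nu>.finite_measure_mono\<close>)
  have Ladd: "L (A \<union> B) = L A + L B" if "A \<in> \<A>" "B \<in> \<A>" "A \<inter> B = {}" for A B
  proof (rule LIMSEQ_unique[OF L])
    have "measure (\<nu> n) (A \<union> B) = measure (\<nu> n) A + measure (\<nu> n) B" for n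
      using that P AB by (intro \<nu>.finite_measure_Union) auto
    then show "(\<lambda>n. measure (\<nu> n) (A \<union> B)) \<longlonglongrightarrow> L A + L B"
      using L that by (simp add: tendsto_add)
  qed (use that in auto)
  have cont: "(\<lambda>i. L (A i)) \<longlonglongrightarrow> 0"
    if A: "range A \<subseteq> \<A>" "decseq A" "(\<Inter>i. A i) = {}" for A :: "nat \<Rightarrow> 'a set"
  proof (rule tendstoI)
    fix e :: real assume e: "0 < e"
    have Ai: "A i \<in> \<A>" for i using A by auto
    \<comment> \<open>The geometric weights make the total loss at most \<open>e / 2\<close> however
      many sets are used, since the index \<open>j\<close> found below is not known yet.\<close>
    have "\<exists>K. compact K \<and> K \<subseteq> A i \<and> (\<forall>\<^sub>F n in sequentially. measure (\<nu> n) (A i - K) < e / 4 * (1/2) ^ i)" for i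
      using tight[OF Ai, of "e / 4 * (1/2) ^ i"] e by simp
    then obtain K where K: "\<And>i. compact (K i)" "\<And>i. K i \<subseteq> A i"
        "\<And>i. \<forall>\<^sub>F n in sequentially. measure (\<nu> n) (A i - K i) < e / 4 * (1/2) ^ i"
      by metis
    have "\<exists>j. (\<Inter>i\<le>j. K i) = {}"
    proof (rule ccontr)
      assume nex: "\<nexists>j. (\<Inter>i\<le>j. K i) = {}"
      have "K 0 \<inter> (\<Inter>i\<in>UNIV. K i) \<noteq> {}"
      proof (rule compact_imp_fip_image)
        fix I' :: "nat set" assume "finite I'"
        then obtain j where j: "I' \<subseteq> {..j}" using finite_nat_iff_bounded_le by auto
        have "(\<Inter>i\<le>j. K i) \<subseteq> K 0 \<inter> (\<Inter>i\<in>I'. K i)" using j by auto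
        then show "K 0 \<inter> (\<Inter>i\<in>I'. K i) \<noteq> {}" using nex by blast
      qed (auto intro: compact_imp_closed K(1))
      then obtain x where "\<And>i. x \<in> K i" by auto
      then have "x \<in> (\<Inter>i. A i)" using K(2) by auto
      then show False using A(3) by simp
    qed
    then obtain j where j: "(\<Inter>i\<le>j. K i) = {}" by blast
    have "\<forall>\<^sub>F n in sequentially. \<forall>i\<in>{..j}. measure (\<nu> n) (A i - K i) < e / 4 * (1/2) ^ i"
      using K(3) by (intro eventually_ball_finite) auto
    then have "\<forall>\<^sub>F n in sequentially. measure (\<nu> n) (A j) \<le> e / 2"
    proof (rule eventually_mono)
      fix n assume n: "\<forall>i\<in>{..j}. measure (\<nu> n) (A i - K i) < e / 4 * (1/2) ^ i"
      have meas: "A i - K i \<in> sets (\<nu> n)" for i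
        unfolding P(2) by (intro sets.Diff AB Ai borel_closed compact_imp_closed K)
      \<comment> \<open>A point of \<open>A j\<close> misses some \<open>K i\<close> with
        \<open>i \<le> j\<close>, as these have no common point, and it lies in \<open>A i\<close>
        because the sets decrease.\<close>
      have sub: "A j \<subseteq> (\<Union>i\<le>j. A i - K i)"
        using j A(2) unfolding decseq_def by blast
      have "measure (\<nu> n) (A j) \<le> measure (\<nu> n) (\<Union>i\<le>j. A i - K i)"
        using sub meas by (intro \<nu>.finite_measure_mono) auto
      also have "\<dots> \<le> (\<Sum>i\<le>j. measure (\<nu> n) (A i - K i))"
        using meas by (intro \<nu>.finite_measure_subadditive_finite) auto
      also have "\<dots> \<le> (\<Sum>i\<le>j. e / 4 * (1/2) ^ i)"
        using n by (intro sum_mono) (auto intro: less_imp_le)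
      also have "\<dots> = e / 4 * (\<Sum>i\<le>j. (1/2) ^ i)" by (simp add: sum_distrib_left)
      also have "\<dots> \<le> e / 4 * 2"
      proof (intro mult_left_mono)
        have "(\<Sum>i\<le>j. (1/2::real) ^ i) = 2 - (1/2) ^ j"
          by (induction j) (auto simp: field_simps)
        then show "(\<Sum>i\<le>j. (1/2::real) ^ i) \<le> 2" by simp
      qed (use e in auto)
      finally show "measure (\<nu> n) (A j) \<le> e / 2" by simp
    qed
    then have "L (A j) \<le> e / 2"
      by (intro tendsto_upperbound[OF L[OF Ai]]) auto
    then have "dist (L (A i)) 0 < e" if "j \<le> i" for i
      using Lmono[OF Ai Ai, of i j] L0[OF Ai, of i] A(2) that e
      by (auto simp: decseq_def)
    then show "\<forall>\<^sub>F i in sequentially. dist (L (A i)) 0 < e"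
      by (auto simp: eventually_sequentially)
  qed
  obtain \<mu> :: "'a set \<Rightarrow> ennreal" where \<mu>: "\<forall>s\<in>\<A>. \<mu> s = ennreal (L s)"
      "measure_space UNIV (sigma_sets UNIV \<A>) \<mu>"
  proof -
    have "\<exists>\<mu> :: 'a set \<Rightarrow> ennreal. (\<forall>s\<in>\<A>. \<mu> s = ennreal (L s)) \<and> measure_space UNIV (sigma_sets UNIV \<A>) \<mu>"
    proof (rule \<A>.caratheodory_empty_continuous)
      have "L {} = 0" using Ladd[of "{}" "{}"] by simp
      then show "positive \<A> (\<lambda>s. ennreal (L s))" by (simp add: positive_def)
      show "additive \<A> (\<lambda>s. ennreal (L s))"
        by (auto simp: additive_def Ladd L0)
      show "(\<lambda>i. ennreal (L (A i))) \<longlonglongrightarrow> 0" if "range A \<subseteq> \<A>" "decseq A" "(\<Inter>i. A i) = {}" for A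
        using tendsto_ennrealI[OF cont[OF that]] by simp
    qed auto
    then show ?thesis using that by blast
  qed
  define \<kappa> where "\<kappa> = measure_of UNIV (sigma_sets UNIV \<A>) \<mu>"
  have sets_\<kappa>: "sets \<kappa> = sets borel"
    unfolding \<kappa>_def gen by (simp add: sigma_sets_sigma_sets_eq)
  have em: "emeasure \<kappa> A = ennreal (L A)" if "A \<in> \<A>" for A
  proof -
    have "emeasure \<kappa> A = \<mu> A"
      unfolding \<kappa>_def
      by (rule emeasure_measure_of_sigma)
        (use \<mu>(2) that in \<open>auto simp: measure_space_def\<close>)
    then show ?thesis using \<mu>(1) that by simp
  qed
  have "L UNIV = 1"
  proof (rule LIMSEQ_unique[OF L])
    show "(\<lambda>n. measure (\<nu> n) UNIV) \<longlonglongrightarrow> 1"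
      using \<nu>.prob_space P(3) by simp
  qed auto
  then have "prob_space \<kappa>"
    using em[of UNIV] sets_eq_imp_space_eq[OF sets_\<kappa>] by (intro prob_spaceI) simp
  moreover have "measure \<kappa> A = L A" if "A \<in> \<A>" for A
    using em[OF that] L0[OF that] by (simp add: measure_def)
  ultimately show ?thesis
    using sets_\<kappa> L by (intro bexI[of _ \<kappa>]) (auto simp: space_prob_algebra)
qed

subsection \<open>Kernels\<close>

text \<open>An open set contains a member of \<open>\<A>\<close> carrying almost all of its
  \<open>N\<close>-mass. Convergence on that member bounds the masses of the open set from below,
  which is the open-set criterion.\<close>

lemma weakly_converges_to_if_algebra:
  fixes N :: "'a::topological_space measure"
  assumes M: "\<And>n. M n \<in> space (prob_algebra borel)" and N: "N \<in> space (prob_algebra borel)"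
    and \<A>: "\<A> \<subseteq> sets borel" "\<And>W. open W \<Longrightarrow> \<exists>I. range I \<subseteq> \<A> \<and> incseq I \<and> W = (\<Union>n::nat. I n)"
    and lim: "\<And>A. A \<in> \<A> \<Longrightarrow> (\<lambda>n. measure (M n) A) \<longlonglongrightarrow> measure N A"
  shows "weakly_converges_to M N"
proof (rule weakly_converges_to_if_open_liminf[OF M N])
  fix W :: "'a set" and e :: real assume W: "open W" and e: "0 < e"
  interpret N: prob_space N using N by (simp add: space_prob_algebra)
  have sN: "sets N = sets borel" and sM: "sets (M n) = sets borel" for n
    using M N by (auto simp: space_prob_algebra)
  obtain I :: "nat \<Rightarrow> 'a set" where I: "range I \<subseteq> \<A>" "incseq I" "W = (\<Union>n. I n)"
    using \<A>(2)[OF W] by blast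
  have "(\<lambda>k. measure N (I k)) \<longlonglongrightarrow> measure N W"
    unfolding I(3) using I(1,2) \<A>(1) sN by (intro N.finite_Lim_measure_incseq) auto
  then have "\<forall>\<^sub>F k in sequentially. measure N W - e / 2 < measure N (I k)"
    using e by (intro order_tendstoD(1)) auto
  then obtain k where k: "measure N W - e / 2 < measure N (I k)"
    by (auto simp: eventually_sequentially)
  have Ik: "I k \<in> \<A>" using I(1) by auto
  have "\<forall>\<^sub>F n in sequentially. measure N (I k) - e / 2 < measure (M n) (I k)"
    using e by (intro order_tendstoD(1)[OF lim[OF Ik]]) auto
  then show "\<forall>\<^sub>F n in sequentially. measure N W - e < measure (M n) W"
  proof (rule eventually_mono)
    fix n assume n: "measure N (I k) - e / 2 < measure (M n) (I k)"
    interpret Mn: prob_space "M n" using M[of n] by (simp add: space_prob_algebra)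
    have "measure (M n) (I k) \<le> measure (M n) W"
      using I(3) W sM by (intro Mn.finite_measure_mono) auto
    then show "measure N W - e < measure (M n) W" using n k by linarith
  qed
qed

text \<open>Allows the sequence of pull-backs to start at an index where all running times are
  nonnegative.\<close>

lemma weakly_converges_to_ignore_initial_segment:
  "weakly_converges_to (\<lambda>n. M (n + k)) N \<longleftrightarrow> weakly_converges_to M N"
  unfolding weakly_converges_to_def
  using LIMSEQ_offset[where k=k] LIMSEQ_ignore_initial_segment[where k=k] by fast

lemma kernel_section_measurable:
  assumes "K \<in> M \<rightarrow>\<^sub>M prob_algebra N" "D \<in> sets (M \<Otimes>\<^sub>M N)"
  shows "(\<lambda>\<omega>. measure (K \<omega>) (Pair \<omega> -` D)) \<in> borel_measurable M"
proof (rule measure_measurable_prob_algebra2[OF _ assms(1)])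
  have "Sigma (space M) (\<lambda>\<omega>. Pair \<omega> -` D) = D"
    using sets.sets_into_space[OF assms(2)] by (auto simp: space_pair_measure)
  then show "Sigma (space M) (\<lambda>\<omega>. Pair \<omega> -` D) \<in> sets (M \<Otimes>\<^sub>M N)" using assms(2) by simp
qed

lemma subalgebra_pair_sets:
  assumes "subalgebra M F"
  shows "sets (F \<Otimes>\<^sub>M N) \<subseteq> sets (M \<Otimes>\<^sub>M N)"
  using assms unfolding sets_pair_measure subalgebra_def
  by (auto intro!: sigma_sets_mono')

lemma measurable_pair_from_subalgebra:
  assumes "subalgebra M F" "f \<in> F \<Otimes>\<^sub>M N \<rightarrow>\<^sub>M K"
  shows "f \<in> M \<Otimes>\<^sub>M N \<rightarrow>\<^sub>M K"
proof (rule measurable_from_subalg[OF _ assms(2)])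
  show "subalgebra (M \<Otimes>\<^sub>M N) (F \<Otimes>\<^sub>M N)"
    using subalgebra_pair_sets[OF assms(1)] assms(1)
    by (auto simp: subalgebra_def space_pair_measure)
qed

text \<open>
  The means of the sections under \<open>\<nu> n\<close> do not depend on \<open>n\<close>. This replaces the uniform
  integrability that passing to countable disjoint unions needs.
\<close>

lemma (in prob_space) kernel_L1_convergence:
  fixes \<nu> :: "nat \<Rightarrow> 'a \<Rightarrow> 'b measure"
  assumes F: "subalgebra M F"
    and \<nu>: "\<And>n. \<nu> n \<in> M \<rightarrow>\<^sub>M prob_algebra N" and \<kappa>: "\<kappa> \<in> M \<rightarrow>\<^sub>M prob_algebra N"
    and \<sigma>: "\<sigma> \<in> M \<rightarrow>\<^sub>M prob_algebra N"
    and mean: "\<And>n D. D \<in> sets (F \<Otimes>\<^sub>M N) \<Longrightarrow>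
      (\<integral>\<omega>. measure (\<nu> n \<omega>) (Pair \<omega> -` D) \<partial>M) = (\<integral>\<omega>. measure (\<sigma> \<omega>) (Pair \<omega> -` D) \<partial>M)"
    and \<A>: "algebra (space N) \<A>" "sets N = sigma_sets (space N) \<A>"
    and lim: "\<And>A. A \<in> \<A> \<Longrightarrow> AE \<omega> in M. (\<lambda>n. measure (\<nu> n \<omega>) A) \<longlonglongrightarrow> measure (\<kappa> \<omega>) A"
    and D: "D \<in> sets (F \<Otimes>\<^sub>M N)"
  shows "(\<lambda>n. \<integral>\<omega>. \<bar>measure (\<nu> n \<omega>) (Pair \<omega> -` D) - measure (\<kappa> \<omega>) (Pair \<omega> -` D)\<bar> \<partial>M) \<longlonglongrightarrow> 0"
proof -
  interpret \<A>: algebra "space N" \<A> by fact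
  have spF: "space F = space M" and setsF: "sets F \<subseteq> sets M"
    using F by (auto simp: subalgebra_def)
  have DM: "D \<in> sets (M \<Otimes>\<^sub>M N)" if "D \<in> sets (F \<Otimes>\<^sub>M N)" for D
    using that subalgebra_pair_sets[OF F] by auto
  have prob: "prob_space (K \<omega>)" "sets (K \<omega>) = sets N" "space (K \<omega>) = space N"
    if "K \<in> M \<rightarrow>\<^sub>M prob_algebra N" "\<omega> \<in> space M" for K \<omega>
    using measurable_space[OF that] sets_eq_imp_space_eq[of "K \<omega>" N] by (auto simp: space_prob_algebra)
  have sec: "Pair \<omega> -` D \<in> sets N" if "D \<in> sets (F \<Otimes>\<^sub>M N)" for D \<omega>
    using that by (rule sets_Pair1)
  note km = kernel_section_measurable[OF _ DM]
  have le1: "measure (K \<omega>) X \<le> 1" if "K \<in> M \<rightarrow>\<^sub>M prob_algebra N" "\<omega> \<in> space M" for K \<omega> X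
    using prob_space.prob_le_1[OF prob(1)[OF that]] .
  have kint: "integrable M (\<lambda>\<omega>. measure (K \<omega>) (Pair \<omega> -` D))"
    if "K \<in> M \<rightarrow>\<^sub>M prob_algebra N" "D \<in> sets (F \<Otimes>\<^sub>M N)" for K D
    using le1[OF that(1)] by (intro integrable_const_bound[where B=1] km that) auto
  have dint: "integrable M (\<lambda>\<omega>. \<bar>measure (\<nu> n \<omega>) (Pair \<omega> -` D) - measure (\<kappa> \<omega>) (Pair \<omega> -` D)\<bar>)"
    if "D \<in> sets (F \<Otimes>\<^sub>M N)" for n D
    by (intro integrable_abs Bochner_Integration.integrable_diff kint \<nu> \<kappa> that)
  \<comment> \<open>The second sides of the generating rectangles are taken from
    \<open>\<A>\<close>, because pointwise convergence is assumed only there.\<close>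
  have gen: "sets (F \<Otimes>\<^sub>M N) = sigma_sets (space F \<times> space N) {A \<times> B |A B. A \<in> sets F \<and> B \<in> \<A>}"
  proof -
    have "sets (F \<Otimes>\<^sub>M N) = sets (sigma (space F \<times> space N) {A \<times> B |A B. A \<in> sets F \<and> B \<in> \<A>})"
      using \<A>.space_closed
      by (intro sets_pair_eq[where Ca="{space F}" and Cb="{space N}"])
        (auto simp: sets.space_closed sets.sigma_sets_eq \<A>(2))
    also have "\<dots> = sigma_sets (space F \<times> space N) {A \<times> B |A B. A \<in> sets F \<and> B \<in> \<A>}"
      using \<A>.space_closed sets.space_closed[of F] by (intro sets_measure_of) auto
    finally show ?thesis .
  qed
  let ?e = "\<lambda>D n. \<integral>\<omega>. \<bar>measure (\<nu> n \<omega>) (Pair \<omega> -` D) - measure (\<kappa> \<omega>) (Pair \<omega> -` D)\<bar> \<partial>M"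
  have stable: "Int_stable {A \<times> B |A B. A \<in> sets F \<and> B \<in> \<A>}"
  proof (rule Int_stableI)
    fix X Y assume "X \<in> {A \<times> B |A B. A \<in> sets F \<and> B \<in> \<A>}" "Y \<in> {A \<times> B |A B. A \<in> sets F \<and> B \<in> \<A>}"
    then obtain A B A' B' where AB: "X = A \<times> B" "Y = A' \<times> B'" "A \<in> sets F" "A' \<in> sets F" "B \<in> \<A>" "B' \<in> \<A>"
      by auto
    then have "X \<inter> Y = (A \<inter> A') \<times> (B \<inter> B')" by auto
    then show "X \<inter> Y \<in> {A \<times> B |A B. A \<in> sets F \<and> B \<in> \<A>}" using AB by blast
  qed
  have closed: "{A \<times> B |A B. A \<in> sets F \<and> B \<in> \<A>} \<subseteq> Pow (space F \<times> space N)"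
    using \<A>.space_closed sets.space_closed[of F] by auto
  show "?e D \<longlonglongrightarrow> 0"
    using stable closed D[unfolded gen]
  proof (induction D rule: sigma_sets_induct_disjoint)
    case (basic D)
    then obtain A B where AB: "D = A \<times> B" "A \<in> sets F" "B \<in> \<A>" by auto
    \<comment> \<open>On a rectangle \<open>A \<times> B\<close> the section is either
      \<open>B\<close> or empty according to the sample point, so convergence on the single set
      \<open>B\<close> is enough. The bound 2 is the sum of two masses.\<close>
    have "(\<lambda>n. ?e D n) \<longlonglongrightarrow> (\<integral>\<omega>. 0 \<partial>M)"
    proof (rule integral_dominated_convergence[where w="\<lambda>_. 2"])
      have Dm: "D \<in> sets (F \<Otimes>\<^sub>M N)" using basic unfolding gen by (rule sigma_sets.Basic)
      show "(\<lambda>\<omega>. \<bar>measure (\<nu> n \<omega>) (Pair \<omega> -` D) - measure (\<kappa> \<omega>) (Pair \<omega> -` D)\<bar>) \<in> borel_measurable M" for n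
        by (rule borel_measurable_integrable[OF dint[OF Dm]])
      show "AE \<omega> in M. norm \<bar>measure (\<nu> n \<omega>) (Pair \<omega> -` D) - measure (\<kappa> \<omega>) (Pair \<omega> -` D)\<bar> \<le> 2" for n
      proof (rule AE_I2)
        fix \<omega> assume "\<omega> \<in> space M"
        from le1[OF \<nu> this, of n "Pair \<omega> -` D"] le1[OF \<kappa> this, of "Pair \<omega> -` D"]
        show "norm \<bar>measure (\<nu> n \<omega>) (Pair \<omega> -` D) - measure (\<kappa> \<omega>) (Pair \<omega> -` D)\<bar> \<le> 2"
          using measure_nonneg[of "\<nu> n \<omega>" "Pair \<omega> -` D"] measure_nonneg[of "\<kappa> \<omega>" "Pair \<omega> -` D"]
          unfolding real_norm_def by linarith
      qed
      show "AE \<omega> in M. (\<lambda>n. \<bar>measure (\<nu> n \<omega>) (Pair \<omega> -` D) - measure (\<kappa> \<omega>) (Pair \<omega> -` D)\<bar>) \<longlonglongrightarrow> 0"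
        using lim[OF AB(3)]
      proof (rule AE_mp, intro AE_I2 impI)
        fix \<omega> assume "(\<lambda>n. measure (\<nu> n \<omega>) B) \<longlonglongrightarrow> measure (\<kappa> \<omega>) B"
        then have "(\<lambda>n. \<bar>measure (\<nu> n \<omega>) B - measure (\<kappa> \<omega>) B\<bar>) \<longlonglongrightarrow> 0"
          by (intro tendsto_rabs_zero LIM_zero)
        then show "(\<lambda>n. \<bar>measure (\<nu> n \<omega>) (Pair \<omega> -` D) - measure (\<kappa> \<omega>) (Pair \<omega> -` D)\<bar>) \<longlonglongrightarrow> 0"
          unfolding AB(1) by (cases "\<omega> \<in> A") auto
      qed
    qed auto
    then show ?case by simp
  next
    case empty
    show ?case by simp
  next
    case (compl D)
    then have Dm: "D \<in> sets (F \<Otimes>\<^sub>M N)" by (simp add: gen)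
    \<comment> \<open>Both kernels consist of probability measures, so passing to the complement
      only changes the sign of the difference.\<close>
    have "?e (space F \<times> space N - D) n = ?e D n" for n
    proof (rule Bochner_Integration.integral_cong[OF refl])
      fix \<omega> assume \<omega>: "\<omega> \<in> space M"
      have eq: "Pair \<omega> -` (space F \<times> space N - D) = space N - Pair \<omega> -` D"
        using \<omega> spF by auto
      have "measure (K \<omega>) (space N - Pair \<omega> -` D) = 1 - measure (K \<omega>) (Pair \<omega> -` D)"
        if "K \<in> M \<rightarrow>\<^sub>M prob_algebra N" for K
        using prob_space.prob_compl[OF prob(1)[OF that \<omega>], of "Pair \<omega> -` D"] prob(2,3)[OF that \<omega>] sec[OF Dm]
        by simp
      from this[OF \<nu>] this[OF \<kappa>]
      show "\<bar>measure (\<nu> n \<omega>) (Pair \<omega> -` (space F \<times> space N - D)) - measure (\<kappa> \<omega>) (Pair \<omega> -` (space F \<times> space N - D))\<bar>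
        = \<bar>measure (\<nu> n \<omega>) (Pair \<omega> -` D) - measure (\<kappa> \<omega>) (Pair \<omega> -` D)\<bar>"
        unfolding eq by simp
    qed
    then show ?case using compl.IH by simp
  next
    case (union E)
    then have Em: "E i \<in> sets (F \<Otimes>\<^sub>M N)" for i by (auto simp: gen)
    \<comment> \<open>Tails of the union. The first \<open>k\<close> pieces are left to the
      induction hypothesis; as the pieces are disjoint, the tails decrease to the empty set and
      their mean masses under \<open>\<sigma>\<close> and \<open>\<kappa>\<close> vanish.\<close>
    define R where "R k = (\<Union>i\<in>{k..}. E i)" for k
    have Rm: "R k \<in> sets (F \<Otimes>\<^sub>M N)" for k unfolding R_def using Em by auto
    have UEm: "(\<Union>i. E i) \<in> sets (F \<Otimes>\<^sub>M N)" using Em by auto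
    have split: "measure (K \<omega>) (Pair \<omega> -` (\<Union>i. E i))
        = (\<Sum>i<k. measure (K \<omega>) (Pair \<omega> -` E i)) + measure (K \<omega>) (Pair \<omega> -` R k)"
      if "K \<in> M \<rightarrow>\<^sub>M prob_algebra N" "\<omega> \<in> space M" for K \<omega> k
    proof -
      interpret K: prob_space "K \<omega>" by (rule prob[OF that])
      have "disjoint_family_on (\<lambda>i. Pair \<omega> -` E i) {..<k}"
        using union.hyps unfolding disjoint_family_on_def by blast
      then have 1: "measure (K \<omega>) (\<Union>i<k. Pair \<omega> -` E i) = (\<Sum>i<k. measure (K \<omega>) (Pair \<omega> -` E i))"
        using sec[OF Em] prob(2)[OF that] by (intro K.finite_measure_finite_Union) auto
      have "Pair \<omega> -` (\<Union>i. E i) = (\<Union>i<k. Pair \<omega> -` E i) \<union> Pair \<omega> -` R k"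
      proof -
        have "{..<k} \<union> {k..} = UNIV" by auto
        then show ?thesis unfolding R_def vimage_UN UN_Un[symmetric] by simp
      qed
      moreover have "(\<Union>i<k. Pair \<omega> -` E i) \<inter> Pair \<omega> -` R k = {}"
      proof -
        have "E i \<inter> E j = {}" if "i < k" "k \<le> j" for i j
        proof -
          have "i \<noteq> j" using that by simp
          then show ?thesis using union.hyps unfolding disjoint_family_on_def by simp
        qed
        then show ?thesis unfolding R_def by blast
      qed
      ultimately show ?thesis
        using sec[OF Em] sec[OF Rm] prob(2)[OF that]
        by (simp add: K.finite_measure_Union sets.countable_UN 1[symmetric])
    qed
    have Rlim: "(\<lambda>k. \<integral>\<omega>. measure (K \<omega>) (Pair \<omega> -` R k) \<partial>M) \<longlonglongrightarrow> 0"
      if K: "K \<in> M \<rightarrow>\<^sub>M prob_algebra N" for K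
    proof -
      have "(\<lambda>k. \<integral>\<omega>. measure (K \<omega>) (Pair \<omega> -` R k) \<partial>M) \<longlonglongrightarrow> (\<integral>\<omega>. 0 \<partial>M)"
      proof (rule integral_dominated_convergence[where w="\<lambda>_. 1"])
        show "AE \<omega> in M. (\<lambda>k. measure (K \<omega>) (Pair \<omega> -` R k)) \<longlonglongrightarrow> 0"
        proof (rule AE_I2)
          fix \<omega> assume \<omega>: "\<omega> \<in> space M"
          interpret K: prob_space "K \<omega>" by (rule prob[OF K \<omega>])
          have "(\<lambda>k. measure (K \<omega>) (Pair \<omega> -` R k)) \<longlonglongrightarrow> measure (K \<omega>) (\<Inter>k. Pair \<omega> -` R k)"
          proof (rule K.finite_Lim_measure_decseq)
            show "range (\<lambda>k. Pair \<omega> -` R k) \<subseteq> sets (K \<omega>)"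
              using sec[OF Rm] prob(2)[OF K \<omega>] by auto
            show "decseq (\<lambda>k. Pair \<omega> -` R k)"
              unfolding R_def decseq_def by force
          qed
          moreover have "(\<Inter>k. Pair \<omega> -` R k) = {}"
          proof (rule ccontr)
            assume "(\<Inter>k. Pair \<omega> -` R k) \<noteq> {}"
            then obtain x where x: "\<And>k. (\<omega>, x) \<in> R k" by auto
            from x[of 0] obtain i where i: "(\<omega>, x) \<in> E i" by (auto simp: R_def)
            from x[of "Suc i"] obtain j where j: "Suc i \<le> j" "(\<omega>, x) \<in> E j" by (auto simp: R_def)
            have "E i \<inter> E j = {}"
            proof -
              have "i \<noteq> j" using j(1) by simp
              then show ?thesis using union.hyps unfolding disjoint_family_on_def by simp
            qed
            then show False using i j(2) by auto
          qed
          ultimately show "(\<lambda>k. measure (K \<omega>) (Pair \<omega> -` R k)) \<longlonglongrightarrow> 0" by simp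
        qed
        show "AE \<omega> in M. norm (measure (K \<omega>) (Pair \<omega> -` R k)) \<le> 1" for k
          using le1[OF K] by (intro AE_I2) auto
        show "(\<lambda>\<omega>. measure (K \<omega>) (Pair \<omega> -` R k)) \<in> borel_measurable M" for k
          by (rule km[OF K Rm])
      qed auto
      then show ?thesis by simp
    qed
    have bound: "?e (\<Union>i. E i) n \<le> (\<Sum>i<k. ?e (E i) n)
        + ((\<integral>\<omega>. measure (\<sigma> \<omega>) (Pair \<omega> -` R k) \<partial>M) + (\<integral>\<omega>. measure (\<kappa> \<omega>) (Pair \<omega> -` R k) \<partial>M))" for n k
    proof -
      have "?e (\<Union>i. E i) n \<le> (\<integral>\<omega>. (\<Sum>i<k. \<bar>measure (\<nu> n \<omega>) (Pair \<omega> -` E i) - measure (\<kappa> \<omega>) (Pair \<omega> -` E i)\<bar>)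
          + (measure (\<nu> n \<omega>) (Pair \<omega> -` R k) + measure (\<kappa> \<omega>) (Pair \<omega> -` R k)) \<partial>M)"
      proof (rule integral_mono)
        fix \<omega> assume \<omega>: "\<omega> \<in> space M"
        have "\<bar>measure (\<nu> n \<omega>) (Pair \<omega> -` (\<Union>i. E i)) - measure (\<kappa> \<omega>) (Pair \<omega> -` (\<Union>i. E i))\<bar>
          = \<bar>(\<Sum>i<k. measure (\<nu> n \<omega>) (Pair \<omega> -` E i) - measure (\<kappa> \<omega>) (Pair \<omega> -` E i))
              + (measure (\<nu> n \<omega>) (Pair \<omega> -` R k) - measure (\<kappa> \<omega>) (Pair \<omega> -` R k))\<bar>"
          unfolding split[OF \<nu> \<omega>, of n k] split[OF \<kappa> \<omega>, of k] by (simp add: sum_subtractf)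
        also have "\<dots> \<le> \<bar>\<Sum>i<k. measure (\<nu> n \<omega>) (Pair \<omega> -` E i) - measure (\<kappa> \<omega>) (Pair \<omega> -` E i)\<bar>
            + (measure (\<nu> n \<omega>) (Pair \<omega> -` R k) + measure (\<kappa> \<omega>) (Pair \<omega> -` R k))"
          using measure_nonneg[of "\<nu> n \<omega>" "Pair \<omega> -` R k"] measure_nonneg[of "\<kappa> \<omega>" "Pair \<omega> -` R k"]
          by linarith
        also have "\<dots> \<le> (\<Sum>i<k. \<bar>measure (\<nu> n \<omega>) (Pair \<omega> -` E i) - measure (\<kappa> \<omega>) (Pair \<omega> -` E i)\<bar>)
            + (measure (\<nu> n \<omega>) (Pair \<omega> -` R k) + measure (\<kappa> \<omega>) (Pair \<omega> -` R k))"
          by (intro add_right_mono sum_abs)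
        finally show "\<bar>measure (\<nu> n \<omega>) (Pair \<omega> -` (\<Union>i. E i)) - measure (\<kappa> \<omega>) (Pair \<omega> -` (\<Union>i. E i))\<bar> \<le> \<dots>" .
      qed (intro dint UEm Bochner_Integration.integrable_add Bochner_Integration.integrable_sum kint \<nu> \<kappa> Rm Em)+
      also have "\<dots> = (\<Sum>i<k. ?e (E i) n)
        + ((\<integral>\<omega>. measure (\<nu> n \<omega>) (Pair \<omega> -` R k) \<partial>M) + (\<integral>\<omega>. measure (\<kappa> \<omega>) (Pair \<omega> -` R k) \<partial>M))"
        using dint[OF Em] kint[OF \<nu> Rm] kint[OF \<kappa> Rm]
        by (simp add: Bochner_Integration.integral_add Bochner_Integration.integral_sum)
      finally show ?thesis unfolding mean[OF Rm] .
    qed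
    show ?case
    proof (rule tendstoI)
      fix e :: real assume e: "0 < e"
      have "(\<lambda>k. (\<integral>\<omega>. measure (\<sigma> \<omega>) (Pair \<omega> -` R k) \<partial>M) + (\<integral>\<omega>. measure (\<kappa> \<omega>) (Pair \<omega> -` R k) \<partial>M)) \<longlonglongrightarrow> 0"
        using tendsto_add[OF Rlim[OF \<sigma>] Rlim[OF \<kappa>]] by simp
      then have "\<forall>\<^sub>F k in sequentially. (\<integral>\<omega>. measure (\<sigma> \<omega>) (Pair \<omega> -` R k) \<partial>M) + (\<integral>\<omega>. measure (\<kappa> \<omega>) (Pair \<omega> -` R k) \<partial>M) < e / 2"
        using e by (intro order_tendstoD(2)) auto
      then obtain k where k: "(\<integral>\<omega>. measure (\<sigma> \<omega>) (Pair \<omega> -` R k) \<partial>M) + (\<integral>\<omega>. measure (\<kappa> \<omega>) (Pair \<omega> -` R k) \<partial>M) < e / 2"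
        by (auto simp: eventually_sequentially)
      have "(\<lambda>n. \<Sum>i<k. ?e (E i) n) \<longlonglongrightarrow> 0"
        using union.IH by (intro tendsto_null_sum) auto
      then have "\<forall>\<^sub>F n in sequentially. (\<Sum>i<k. ?e (E i) n) < e / 2"
        using e by (intro order_tendstoD(2)) auto
      then show "\<forall>\<^sub>F n in sequentially. dist (?e (\<Union>i. E i) n) 0 < e"
      proof (rule eventually_mono)
        fix n assume "(\<Sum>i<k. ?e (E i) n) < e / 2"
        then have "?e (\<Union>i. E i) n < e" using bound[of n k] k by linarith
        moreover have "0 \<le> ?e (\<Union>i. E i) n" by simp
        ultimately show "dist (?e (\<Union>i. E i) n) 0 < e" unfolding dist_real_def by linarith
      qed
    qed
  qed
qed

subsection \<open>Markovian cocycles\<close>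

context markovian_random_dynamical_system
begin

lemma space_F: "s \<le> t \<Longrightarrow> space (\<F> s t) = space P"
  using F_subalgebra[of s t] by (simp add: subalgebra_def)

lemma theta_space: "\<omega> \<in> space P \<Longrightarrow> \<theta> u \<omega> \<in> space P"
  using measurable_space[OF theta_measurable] .

lemma theta_F_measurable:
  assumes "s \<le> t"
  shows "\<theta> u \<in> \<F> (s + u) (t + u) \<rightarrow>\<^sub>M \<F> s t"
proof (rule measurableI)
  show "\<theta> u \<omega> \<in> space (\<F> s t)" if "\<omega> \<in> space (\<F> (s + u) (t + u))" for \<omega>
    using that assms by (simp add: space_F theta_space)
  show "\<theta> u -` A \<inter> space (\<F> (s + u) (t + u)) \<in> sets (\<F> (s + u) (t + u))" if "A \<in> sets (\<F> s t)" for A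
    using that assms F_shift[OF assms, of u] by (auto simp: space_F)
qed

text \<open>A map started at time \<open>a\<close> and run for time \<open>t\<close> sees only the
  noise between \<open>a\<close> and \<open>a + t\<close>: adaptedness at time 0 is transported by
  the shift of the filtration.\<close>

lemma Phi_theta_F_measurable:
  assumes "0 \<le> t"
  shows "(\<lambda>(\<omega>, x). \<Phi> t (\<theta> a \<omega>) x) \<in> \<F> a (a + t) \<Otimes>\<^sub>M borel \<rightarrow>\<^sub>M borel"
proof -
  have [measurable]: "\<theta> a \<in> \<F> a (a + t) \<rightarrow>\<^sub>M \<F> 0 t"
    using theta_F_measurable[of 0 t a] assms by (simp add: add.commute)
  have "(\<lambda>p. (\<lambda>(\<omega>, x). \<Phi> t \<omega> x) (\<theta> a (fst p), snd p)) \<in> \<F> a (a + t) \<Otimes>\<^sub>M borel \<rightarrow>\<^sub>M borel"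
    by (rule measurable_compose[OF _ Phi_adapted[OF assms]]) measurable
  then show ?thesis by (simp add: case_prod_unfold)
qed

lemma Phi_theta_P_measurable:
  assumes "0 \<le> t"
  shows "(\<lambda>(\<omega>, x). \<Phi> t (\<theta> a \<omega>) x) \<in> P \<Otimes>\<^sub>M borel \<rightarrow>\<^sub>M borel"
  by (rule measurable_pair_from_subalgebra[OF F_subalgebra Phi_theta_F_measurable[OF assms]])
    (use assms in simp)

lemma Phi_P_measurable:
  assumes "0 \<le> t"
  shows "(\<lambda>(\<omega>, x). \<Phi> t \<omega> x) \<in> P \<Otimes>\<^sub>M borel \<rightarrow>\<^sub>M borel"
  by (rule measurable_pair_from_subalgebra[OF F_subalgebra Phi_adapted[OF assms]])
    (use assms in simp)

lemma Phi_section_measurable: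
  assumes "0 \<le> t" "\<omega> \<in> space P"
  shows "\<Phi> t \<omega> \<in> borel \<rightarrow>\<^sub>M borel"
  using measurable_compose[OF measurable_Pair1'[OF assms(2)] Phi_P_measurable[OF assms(1)]] by simp

text \<open>Independence as a statement on laws: under \<open>P\<close> the diagonal map into the
  two sub-sigma-algebras has the product of its marginals as law. In this form Fubini's theorem
  applies. \<open>\<F> a b\<close> is one of the generators of the past of \<open>b\<close>, so
  \<open>F_indep\<close> covers it.\<close>

lemma indep_past_future:
  assumes "a \<le> b" "b \<le> c"
  shows "distr P (\<F> b c) (\<lambda>\<omega>. \<omega>) \<Otimes>\<^sub>M distr P (\<F> a b) (\<lambda>\<omega>. \<omega>)
    = distr P (\<F> b c \<Otimes>\<^sub>M \<F> a b) (\<lambda>\<omega>. (\<omega>, \<omega>))"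
proof -
  have sub: "sets (\<F> s t) \<subseteq> events" if "s \<le> t" for s t
    using F_subalgebra[OF that] by (simp add: subalgebra_def)
  have id: "(\<lambda>\<omega>. \<omega>) \<in> P \<rightarrow>\<^sub>M \<F> s t" if "s \<le> t" for s t
    using sub[OF that] space_F[OF that] by (intro measurableI) (auto simp: subset_eq sets.Int_space_eq2)
  \<comment> \<open>The sigma-algebra generated by the identity map into \<open>\<F> s t\<close> is
    \<open>\<F> s t\<close> itself; thus independence of two identity maps is independence of the
    two sigma-algebras.\<close>
  have pre: "sigma_sets (space P) {(\<lambda>\<omega>. \<omega>) -` A \<inter> space P |A. A \<in> sets (\<F> s t)} = sets (\<F> s t)"
    if "s \<le> t" for s t
  proof -
    have "(\<lambda>\<omega>. \<omega>) -` A \<inter> space P = A" if "A \<in> sets (\<F> s t)" for A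
      using sets.sets_into_space[OF that] space_F[OF \<open>s \<le> t\<close>] by auto
    then have "(\<lambda>A. (\<lambda>\<omega>. \<omega>) -` A \<inter> space P) ` sets (\<F> s t) = (\<lambda>A. A) ` sets (\<F> s t)"
      by (rule image_cong[OF refl])
    then have "{(\<lambda>\<omega>. \<omega>) -` A \<inter> space P |A. A \<in> sets (\<F> s t)} = sets (\<F> s t)"
      by (simp add: Setcompr_eq_image)
    then show ?thesis using sets.sigma_sets_eq[of "\<F> s t"] space_F[OF that] by simp
  qed
  have "indep_set (sets (\<F> b c)) (sets (\<F> a b))"
  proof (rule indep_setI)
    fix A B assume AB: "A \<in> sets (\<F> b c)" "B \<in> sets (\<F> a b)"
    then have "B \<in> sigma_sets (space P) (\<Union>r\<in>{..b}. sets (\<F> r b))"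
      using assms(1) by (intro sigma_sets.Basic) auto
    then show "prob (A \<inter> B) = prob A * prob B"
      using indep_setD[OF F_indep[OF assms(2)] AB(1)] by blast
  qed (use sub assms in auto)
  then have "indep_var (\<F> b c) (\<lambda>\<omega>. \<omega>) (\<F> a b) (\<lambda>\<omega>. \<omega>)"
    unfolding indep_var_eq pre[OF assms(1)] pre[OF assms(2)] using id assms by simp
  then show ?thesis unfolding indep_var_distribution_eq by simp
qed

text \<open>
  As \<open>H\<close> only sees \<open>\<F> b c\<close> and the map \<open>\<Phi> (b - a) (\<theta> a \<omega>)\<close> only sees \<open>\<F> a b\<close>, independence allows
  replacing the random image point by its law.
\<close>

lemma nn_integral_push_forward:
  assumes abc: "a \<le> b" "b \<le> c" and H[measurable]: "H \<in> borel_measurable (\<F> b c \<Otimes>\<^sub>M borel)"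
    and \<mu>: "\<mu> \<in> space (prob_algebra borel)"
  shows "(\<integral>\<^sup>+\<omega>. \<integral>\<^sup>+x. H (\<omega>, \<Phi> (b - a) (\<theta> a \<omega>) x) \<partial>\<mu> \<partial>P)
    = (\<integral>\<^sup>+\<omega>. \<integral>\<^sup>+y. H (\<omega>, y) \<partial>distr (P \<Otimes>\<^sub>M \<mu>) borel (\<lambda>(\<omega>, x). \<Phi> (b - a) (\<theta> a \<omega>) x) \<partial>P)"
proof -
  interpret \<mu>: prob_space \<mu> by (rule prob_algebraD[OF \<mu>])
  have s\<mu>[measurable_cong]: "sets \<mu> = sets borel" by (rule prob_algebraD[OF \<mu>])
  define Y where "Y \<omega> x = \<Phi> (b - a) (\<theta> a \<omega>) x" for \<omega> x
  have Y[measurable]: "case_prod Y \<in> \<F> a b \<Otimes>\<^sub>M borel \<rightarrow>\<^sub>M borel"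
    using Phi_theta_F_measurable[of "b - a" a] abc by (simp add: Y_def[abs_def])
  have YP: "case_prod Y \<in> P \<Otimes>\<^sub>M \<mu> \<rightarrow>\<^sub>M borel"
    using Phi_theta_P_measurable[of "b - a" a] abc unfolding Y_def
    by (simp cong: measurable_cong_sets add: sets_pair_measure_cong[OF refl s\<mu>])
  \<comment> \<open>\<open>Pb\<close> and \<open>Pa\<close> are \<open>P\<close> restricted to the
    later and the earlier window. \<open>G\<close> below separates the two roles of the sample
    point, so that the integral over the diagonal becomes an iterated integral.\<close>
  define Pb where "Pb = distr P (\<F> b c) (\<lambda>\<omega>. \<omega>)"
  define Pa where "Pa = distr P (\<F> a b) (\<lambda>\<omega>. \<omega>)"
  have id: "(\<lambda>\<omega>. \<omega>) \<in> P \<rightarrow>\<^sub>M \<F> s t" if "s \<le> t" for s t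
    by (rule measurable_from_subalg[OF F_subalgebra[OF that]]) simp
  have [measurable_cong]: "sets Pb = sets (\<F> b c)" "sets Pa = sets (\<F> a b)"
    by (simp_all add: Pb_def Pa_def)
  interpret Pb: prob_space Pb unfolding Pb_def using id[OF abc(2)] by (rule prob_space_distr)
  interpret Pa: prob_space Pa unfolding Pa_def using id[OF abc(1)] by (rule prob_space_distr)
  define G where "G \<omega> \<omega>' = (\<integral>\<^sup>+x. H (\<omega>, Y \<omega>' x) \<partial>\<mu>)" for \<omega> \<omega>'
  have G[measurable]: "case_prod G \<in> borel_measurable (\<F> b c \<Otimes>\<^sub>M \<F> a b)"
    unfolding G_def by measurable
  have inner: "(\<integral>\<^sup>+\<omega>'. G \<omega> \<omega>' \<partial>P) = (\<integral>\<^sup>+y. H (\<omega>, y) \<partial>distr (P \<Otimes>\<^sub>M \<mu>) borel (case_prod Y))"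
    if "\<omega> \<in> space P" for \<omega>
  proof -
    have [measurable]: "(\<lambda>y. H (\<omega>, y)) \<in> borel_measurable borel"
      by (rule measurable_compose[OF measurable_Pair1' H]) (use that space_F[OF abc(2)] in simp)
    have m: "(\<lambda>z. H (\<omega>, case_prod Y z)) \<in> borel_measurable (P \<Otimes>\<^sub>M \<mu>)"
      by (rule measurable_compose[OF YP]) measurable
    have "(\<integral>\<^sup>+y. H (\<omega>, y) \<partial>distr (P \<Otimes>\<^sub>M \<mu>) borel (case_prod Y)) = (\<integral>\<^sup>+z. H (\<omega>, case_prod Y z) \<partial>(P \<Otimes>\<^sub>M \<mu>))"
      by (rule nn_integral_distr[OF YP]) simp
    also have "\<dots> = (\<integral>\<^sup>+\<omega>'. G \<omega> \<omega>' \<partial>P)"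
      using \<mu>.nn_integral_fst[OF m] by (simp add: G_def)
    finally show ?thesis by simp
  qed
  have "(\<integral>\<^sup>+\<omega>. \<integral>\<^sup>+x. H (\<omega>, Y \<omega> x) \<partial>\<mu> \<partial>P) = (\<integral>\<^sup>+\<omega>. case_prod G (\<omega>, \<omega>) \<partial>P)"
    by (simp add: G_def)
  also have "\<dots> = (\<integral>\<^sup>+z. case_prod G z \<partial>distr P (\<F> b c \<Otimes>\<^sub>M \<F> a b) (\<lambda>\<omega>. (\<omega>, \<omega>)))"
    using id abc by (intro nn_integral_distr[symmetric] measurable_Pair G) auto
  also have "\<dots> = (\<integral>\<^sup>+z. case_prod G z \<partial>(Pb \<Otimes>\<^sub>M Pa))"
    by (simp add: Pb_def Pa_def indep_past_future[OF abc])
  also have "\<dots> = (\<integral>\<^sup>+\<omega>. \<integral>\<^sup>+\<omega>'. G \<omega> \<omega>' \<partial>Pa \<partial>Pb)"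
    by (subst Pa.nn_integral_fst[symmetric]) (auto)
  also have "\<dots> = (\<integral>\<^sup>+\<omega>. \<integral>\<^sup>+\<omega>'. G \<omega> \<omega>' \<partial>Pa \<partial>P)"
  proof -
    have "(\<lambda>\<omega>. \<integral>\<^sup>+\<omega>'. G \<omega> \<omega>' \<partial>Pa) \<in> borel_measurable (\<F> b c)" by measurable
    then show ?thesis
      unfolding Pb_def using id[OF abc(2)] by (subst nn_integral_distr) auto
  qed
  also have "\<dots> = (\<integral>\<^sup>+\<omega>. \<integral>\<^sup>+\<omega>'. G \<omega> \<omega>' \<partial>P \<partial>P)"
  proof (rule nn_integral_cong)
    fix \<omega> assume "\<omega> \<in> space P"
    then have "(\<lambda>\<omega>'. G \<omega> \<omega>') \<in> borel_measurable (\<F> a b)"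
      using measurable_compose[OF measurable_Pair1' G, of \<omega>] space_F[OF abc(2)] by simp
    then show "(\<integral>\<^sup>+\<omega>'. G \<omega> \<omega>' \<partial>Pa) = (\<integral>\<^sup>+\<omega>'. G \<omega> \<omega>' \<partial>P)"
      unfolding Pa_def using id[OF abc(1)] by (subst nn_integral_distr) auto
  qed
  also have "\<dots> = (\<integral>\<^sup>+\<omega>. \<integral>\<^sup>+y. H (\<omega>, y) \<partial>distr (P \<Otimes>\<^sub>M \<mu>) borel (case_prod Y) \<partial>P)"
    by (rule nn_integral_cong) (rule inner)
  finally show ?thesis by (simp add: Y_def[abs_def])
qed

lemma AE_theta:
  assumes "AE \<omega> in P. Q \<omega>"
  shows "AE \<omega> in P. Q (\<theta> u \<omega>)"
proof (rule AE_distrD[OF theta_measurable])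
  show "AE \<omega> in distr P P (\<theta> u). Q \<omega>" unfolding theta_preserving by fact
qed

text \<open>Since \<open>\<theta> a\<close> preserves \<open>P\<close>, the pull-back of the
  exceptional null set is again null, and the cocycle identity may be used from any starting
  time.\<close>

lemma AE_cocycle_theta:
  assumes "0 \<le> s" "0 \<le> t"
  shows "AE \<omega> in P. \<forall>x. \<Phi> (t + s) (\<theta> a \<omega>) x = \<Phi> t (\<theta> (s + a) \<omega>) (\<Phi> s (\<theta> a \<omega>) x)"
  using AE_theta[OF Phi_cocycle[OF assms], of a] AE_space
  by eventually_elim (simp add: theta_add)

end

section \<open>Pull-backs of the periodic law and their martingale property\<close>

locale markovian_rds_periodic_measure = markovian_random_dynamical_system P \<theta> \<F> \<Phi>
  for P :: "'w measure" and \<theta> :: "real \<Rightarrow> 'w \<Rightarrow> 'w"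
    and \<F> :: "real \<Rightarrow> real \<Rightarrow> 'w measure"
    and \<Phi> :: "real \<Rightarrow> 'w \<Rightarrow> 'x::polish_space \<Rightarrow> 'x" +
  fixes \<tau> :: real and \<rho> :: "real \<Rightarrow> 'x measure"
  assumes periodic: "state_periodic_measure P \<Phi> \<tau> \<rho>"
begin

lemma tau_pos: "0 < \<tau>"
  and rho_prob_algebra: "\<rho> s \<in> space (prob_algebra borel)"
  and rho_periodic: "\<rho> (s + \<tau>) = \<rho> s"
  and rho_invariant: "0 \<le> t \<Longrightarrow> B \<in> sets borel \<Longrightarrow>
    measure (\<rho> (t + s)) B = (\<integral>x. transition_prob P \<Phi> t x B \<partial>\<rho> s)"
  using periodic by (auto simp: state_periodic_measure_def)

lemma rho_periodic_nat: "\<rho> (real n * \<tau> + s) = \<rho> s"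
proof (induction n)
  case (Suc n)
  have eq: "real (Suc n) * \<tau> + s = (real n * \<tau> + s) + \<tau>" by (simp add: algebra_simps)
  show ?case unfolding eq using rho_periodic[of "real n * \<tau> + s"] Suc by simp
qed simp

text \<open>With an initial point of law \<open>\<rho> s\<close> drawn independently of the noise,
  Fubini's theorem turns the law of the image into the transition kernel applied to
  \<open>\<rho> s\<close>. The starting time \<open>a\<close> does not affect it because
  \<open>\<theta> a\<close> preserves \<open>P\<close>.\<close>

lemma distr_Phi_rho:
  assumes t: "0 \<le> t"
  shows "distr (P \<Otimes>\<^sub>M \<rho> s) borel (\<lambda>(\<omega>, x). \<Phi> t (\<theta> a \<omega>) x) = \<rho> (t + s)"
proof (rule measure_eqI)
  note \<rho> = prob_algebraD[OF rho_prob_algebra]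
  show "sets (distr (P \<Otimes>\<^sub>M \<rho> s) borel (\<lambda>(\<omega>, x). \<Phi> t (\<theta> a \<omega>) x)) = sets (\<rho> (t + s))"
    by (simp add: \<rho>)
  fix B assume "B \<in> sets (distr (P \<Otimes>\<^sub>M \<rho> s) borel (\<lambda>(\<omega>, x). \<Phi> t (\<theta> a \<omega>) x))"
  then have B[measurable]: "B \<in> sets borel" by simp
  interpret \<rho>s: prob_space "\<rho> s" by (rule \<rho>)
  interpret \<rho>t: prob_space "\<rho> (t + s)" by (rule \<rho>)
  interpret pair_sigma_finite P "\<rho> s" ..
  note [measurable_cong] = \<rho>(2)[of s]
  have m: "(\<lambda>(\<omega>, x). \<Phi> t (\<theta> a \<omega>) x) \<in> P \<Otimes>\<^sub>M \<rho> s \<rightarrow>\<^sub>M borel" for a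
    using Phi_theta_P_measurable[OF t, of a]
    by (simp cong: measurable_cong_sets add: sets_pair_measure_cong[OF refl \<rho>(2)])
  have m0: "(\<lambda>(\<omega>, x). \<Phi> t \<omega> x) \<in> P \<Otimes>\<^sub>M \<rho> s \<rightarrow>\<^sub>M borel"
    using Phi_P_measurable[OF t]
    by (simp cong: measurable_cong_sets add: sets_pair_measure_cong[OF refl \<rho>(2)])
  have S: "(\<lambda>(\<omega>, x). \<Phi> t (\<theta> a \<omega>) x) -` B \<inter> space (P \<Otimes>\<^sub>M \<rho> s) \<in> sets (P \<Otimes>\<^sub>M \<rho> s)"
    using m B by (rule measurable_sets)
  have S0: "(\<lambda>(\<omega>, x). \<Phi> t \<omega> x) -` B \<inter> space (P \<Otimes>\<^sub>M \<rho> s) \<in> sets (P \<Otimes>\<^sub>M \<rho> s)"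
    using m0 B by (rule measurable_sets)
  have tp: "emeasure P ((\<lambda>\<omega>. (\<omega>, x)) -` ((\<lambda>(\<omega>, x). \<Phi> t (\<theta> a \<omega>) x) -` B \<inter> space (P \<Otimes>\<^sub>M \<rho> s)))
      = ennreal (transition_prob P \<Phi> t x B)" for x
  proof -
    have mx: "{\<omega>\<in>space P. \<Phi> t \<omega> x \<in> B} \<in> sets P"
      using sets_Pair2[OF S0, of x] by (simp add: vimage_def space_pair_measure \<rho> Int_def conj_commute)
    have "(\<lambda>\<omega>. (\<omega>, x)) -` ((\<lambda>(\<omega>, x). \<Phi> t (\<theta> a \<omega>) x) -` B \<inter> space (P \<Otimes>\<^sub>M \<rho> s))
      = \<theta> a -` {\<omega>\<in>space P. \<Phi> t \<omega> x \<in> B} \<inter> space P"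
      by (auto simp: space_pair_measure \<rho> theta_space)
    then have "emeasure P ((\<lambda>\<omega>. (\<omega>, x)) -` ((\<lambda>(\<omega>, x). \<Phi> t (\<theta> a \<omega>) x) -` B \<inter> space (P \<Otimes>\<^sub>M \<rho> s)))
      = emeasure (distr P P (\<theta> a)) {\<omega>\<in>space P. \<Phi> t \<omega> x \<in> B}"
      using mx by (simp add: emeasure_distr[OF theta_measurable])
    then show ?thesis
      by (simp add: theta_preserving transition_prob_def emeasure_eq_measure)
  qed
  have "emeasure (distr (P \<Otimes>\<^sub>M \<rho> s) borel (\<lambda>(\<omega>, x). \<Phi> t (\<theta> a \<omega>) x)) B
      = (\<integral>\<^sup>+x. ennreal (transition_prob P \<Phi> t x B) \<partial>\<rho> s)"
    unfolding emeasure_distr[OF m B] emeasure_pair_measure_alt2[OF S] tp ..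
  also have "\<dots> = ennreal (\<integral>x. transition_prob P \<Phi> t x B \<partial>\<rho> s)"
  proof (rule nn_integral_eq_integral)
    have "(\<lambda>x. ennreal (transition_prob P \<Phi> t x B)) \<in> borel_measurable (\<rho> s)"
      unfolding tp[symmetric] using S by (rule measurable_emeasure_Pair2)
    \<comment> \<open>The transition probability is only integrated in the hypothesis on
      \<open>\<rho>\<close>; its measurability in \<open>x\<close> is recovered from that of the
      section measures.\<close>
    then have "(\<lambda>x. enn2real (ennreal (transition_prob P \<Phi> t x B))) \<in> borel_measurable (\<rho> s)"
      by measurable
    then have "(\<lambda>x. transition_prob P \<Phi> t x B) \<in> borel_measurable (\<rho> s)"
      by (simp add: transition_prob_def)
    then show "integrable (\<rho> s) (\<lambda>x. transition_prob P \<Phi> t x B)"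
      by (intro \<rho>s.integrable_const_bound[where B=1]) (auto simp: transition_prob_def)
  qed (simp add: transition_prob_def)
  also have "\<dots> = emeasure (\<rho> (t + s)) B"
    using rho_invariant[OF t B, of s] by (simp add: \<rho>t.emeasure_eq_measure)
  finally show "emeasure (distr (P \<Otimes>\<^sub>M \<rho> s) borel (\<lambda>(\<omega>, x). \<Phi> t (\<theta> a \<omega>) x)) B = emeasure (\<rho> (t + s)) B" .
qed

text \<open>Indexed by the running time alone: \<open>\<rho> 0\<close> is started at time
  \<open>- t\<close> and observed at time 0 on the noise path \<open>\<omega>\<close>. The pair of
  \<open>n\<close> and \<open>s\<close> enters only through this time.\<close>

definition pullback :: "real \<Rightarrow> 'w \<Rightarrow> 'x measure" where
  "pullback t \<omega> = distr (\<rho> 0) borel (\<Phi> t (\<theta> (- t) \<omega>))"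

lemma pullback_measure_eq: "pullback_measure \<theta> \<Phi> \<tau> \<rho> s \<omega> n = pullback (real n * \<tau> + s) \<omega>"
  by (simp add: pullback_measure_def pullback_def)

lemma pullback_F_measurable:
  assumes "0 \<le> t"
  shows "pullback t \<in> \<F> (- t) 0 \<rightarrow>\<^sub>M prob_algebra borel"
  unfolding pullback_def
  using Phi_theta_F_measurable[OF assms, of "- t"] rho_prob_algebra
  by (intro measurable_distr_prob_space2 measurable_const) auto

lemma pullback_measurable:
  assumes "0 \<le> t"
  shows "pullback t \<in> P \<rightarrow>\<^sub>M prob_algebra borel"
  by (rule measurable_from_subalg[OF F_subalgebra pullback_F_measurable[OF assms]]) (use assms in simp)

lemma nn_integral_pullback:
  assumes t: "0 \<le> t" and \<omega>: "\<omega> \<in> space P" and h: "h \<in> borel_measurable borel"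
  shows "(\<integral>\<^sup>+x. h x \<partial>pullback t \<omega>) = (\<integral>\<^sup>+x. h (\<Phi> t (\<theta> (- t) \<omega>) x) \<partial>\<rho> 0)"
proof -
  have "\<Phi> t (\<theta> (- t) \<omega>) \<in> \<rho> 0 \<rightarrow>\<^sub>M borel"
    using Phi_section_measurable[OF t theta_space[OF \<omega>]] prob_algebraD(2)[OF rho_prob_algebra]
    by (simp cong: measurable_cong_sets)
  then show ?thesis unfolding pullback_def using h by (subst nn_integral_distr) auto
qed

text \<open>The pull-back depends on the noise before time 0 and the sections of \<open>D\<close> on
  the noise after it. By independence the pull-back may be replaced by its mean, which is
  \<open>\<rho> t\<close>, even though the tested set is random.\<close>

lemma pullback_mean:
  assumes t: "0 \<le> t" and c: "0 \<le> c" and D: "D \<in> sets (\<F> 0 c \<Otimes>\<^sub>M borel)"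
  shows "(\<integral>\<omega>. measure (pullback t \<omega>) (Pair \<omega> -` D) \<partial>P) = (\<integral>\<omega>. measure (\<rho> t) (Pair \<omega> -` D) \<partial>P)"
proof -
  have sec: "Pair \<omega> -` D \<in> sets borel" for \<omega> using D by (rule sets_Pair1)
  have DP: "D \<in> sets (P \<Otimes>\<^sub>M borel)"
    using subalgebra_pair_sets[OF F_subalgebra[OF c]] D by auto
  have pr: "prob_space (pullback t \<omega>)" "sets (pullback t \<omega>) = sets borel" if "\<omega> \<in> space P" for \<omega>
    using prob_algebraD[OF measurable_space[OF pullback_measurable[OF t] that]] by auto
  note \<rho> = prob_algebraD[OF rho_prob_algebra]
  \<comment> \<open>The running time is written \<open>0 - - t\<close> to fit
    \<open>nn_integral_push_forward\<close> with window from \<open>- t\<close> to 0.\<close>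
  have "(\<integral>\<^sup>+\<omega>. emeasure (pullback t \<omega>) (Pair \<omega> -` D) \<partial>P) = (\<integral>\<^sup>+\<omega>. \<integral>\<^sup>+x. indicator D (\<omega>, \<Phi> (0 - - t) (\<theta> (- t) \<omega>) x) \<partial>\<rho> 0 \<partial>P)"
  proof (rule nn_integral_cong)
    fix \<omega> assume \<omega>: "\<omega> \<in> space P"
    have "emeasure (pullback t \<omega>) (Pair \<omega> -` D) = (\<integral>\<^sup>+x. indicator (Pair \<omega> -` D) x \<partial>pullback t \<omega>)"
      using sec pr(2)[OF \<omega>] by simp
    also have "\<dots> = (\<integral>\<^sup>+x. indicator (Pair \<omega> -` D) (\<Phi> t (\<theta> (- t) \<omega>) x) \<partial>\<rho> 0)"
      using sec by (intro nn_integral_pullback[OF t \<omega>]) simp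
    finally show "emeasure (pullback t \<omega>) (Pair \<omega> -` D) = (\<integral>\<^sup>+x. indicator D (\<omega>, \<Phi> (0 - - t) (\<theta> (- t) \<omega>) x) \<partial>\<rho> 0)"
      by (simp add: indicator_def)
  qed
  also have "\<dots> = (\<integral>\<^sup>+\<omega>. \<integral>\<^sup>+y. indicator D (\<omega>, y) \<partial>distr (P \<Otimes>\<^sub>M \<rho> 0) borel (\<lambda>(\<omega>, x). \<Phi> (0 - - t) (\<theta> (- t) \<omega>) x) \<partial>P)"
    using t c D by (intro nn_integral_push_forward[where c=c] rho_prob_algebra) auto
  also have "\<dots> = (\<integral>\<^sup>+\<omega>. \<integral>\<^sup>+y. indicator (Pair \<omega> -` D) y \<partial>\<rho> t \<partial>P)"
    using distr_Phi_rho[OF t, of 0 "- t"] by (simp add: indicator_def)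
  also have "\<dots> = (\<integral>\<^sup>+\<omega>. emeasure (\<rho> t) (Pair \<omega> -` D) \<partial>P)"
    using sec \<rho> by simp
  finally have *: "(\<integral>\<^sup>+\<omega>. emeasure (pullback t \<omega>) (Pair \<omega> -` D) \<partial>P) = (\<integral>\<^sup>+\<omega>. emeasure (\<rho> t) (Pair \<omega> -` D) \<partial>P)" .
  interpret \<rho>t: prob_space "\<rho> t" by (rule \<rho>)
  have "(\<integral>\<^sup>+\<omega>. emeasure (pullback t \<omega>) (Pair \<omega> -` D) \<partial>P) = (\<integral>\<^sup>+\<omega>. ennreal (measure (pullback t \<omega>) (Pair \<omega> -` D)) \<partial>P)"
    by (intro nn_integral_cong finite_measure.emeasure_eq_measure prob_space.finite_measure pr)
  moreover have "(\<integral>\<^sup>+\<omega>. emeasure (\<rho> t) (Pair \<omega> -` D) \<partial>P) = (\<integral>\<^sup>+\<omega>. ennreal (measure (\<rho> t) (Pair \<omega> -` D)) \<partial>P)"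
    by (simp add: \<rho>t.emeasure_eq_measure)
  ultimately show ?thesis
    using * kernel_section_measurable[OF pullback_measurable[OF t] DP]
      kernel_section_measurable[OF measurable_const[OF rho_prob_algebra] DP]
    by (simp add: integral_eq_nn_integral)
qed

lemma pullback_mean_set:
  assumes t: "0 \<le> t" and B: "B \<in> sets borel"
  shows "(\<integral>\<omega>. measure (pullback t \<omega>) B \<partial>P) = measure (\<rho> t) B"
proof -
  \<comment> \<open>A deterministic set is a cylinder over the sample space, measurable already for
    the degenerate window from 0 to 0.\<close>
  have D: "space P \<times> B \<in> sets (\<F> 0 0 \<Otimes>\<^sub>M borel)"
    using B space_F[of 0 0] sets.top[of "\<F> 0 0"] by (intro pair_measureI) auto
  have "(\<integral>\<omega>. measure (pullback t \<omega>) B \<partial>P) = (\<integral>\<omega>. measure (pullback t \<omega>) (Pair \<omega> -` (space P \<times> B)) \<partial>P)"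
    by (intro Bochner_Integration.integral_cong) auto
  also have "\<dots> = (\<integral>\<omega>. measure (\<rho> t) (Pair \<omega> -` (space P \<times> B)) \<partial>P)"
    by (rule pullback_mean[OF t order_refl D])
  also have "\<dots> = (\<integral>\<omega>. measure (\<rho> t) B \<partial>P)"
    by (intro Bochner_Integration.integral_cong) auto
  finally show ?thesis by (simp add: prob_space)
qed

lemma pullback_martingale:
  assumes t: "0 \<le> t" and A: "A \<in> sets (\<F> (- t) 0)" and B: "B \<in> sets borel"
  shows "(\<integral>\<omega>\<in>A. measure (pullback (t + \<tau>) \<omega>) B \<partial>P) = (\<integral>\<omega>\<in>A. measure (pullback t \<omega>) B \<partial>P)"
proof -
  have AP: "A \<in> sets P" using F_subalgebra[of "- t" 0] A t by (auto simp: subalgebra_def)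
  have t': "0 \<le> t + \<tau>" using t tau_pos by simp
  have pr: "prob_space (pullback t \<omega>)" "sets (pullback t \<omega>) = sets borel" if "\<omega> \<in> space P" "0 \<le> t" for t \<omega>
    using prob_algebraD[OF measurable_space[OF pullback_measurable[OF that(2)] that(1)]] by auto
  have em: "emeasure (pullback t \<omega>) B = (\<integral>\<^sup>+x. indicator B (\<Phi> t (\<theta> (- t) \<omega>) x) \<partial>\<rho> 0)"
    if "\<omega> \<in> space P" "0 \<le> t" for t \<omega>
    using nn_integral_pullback[OF that(2,1), of "indicator B"] B pr(2)[OF that] by simp
  \<comment> \<open>\<open>H\<close> collects all that depends on the noise after
    \<open>- t\<close>: the conditioning event and the last stretch of the motion. What remains is
    the first stretch, of length \<open>\<tau>\<close>, which carries \<open>\<rho> 0\<close> to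
    itself in mean.\<close>
  define H :: "'w \<times> 'x \<Rightarrow> ennreal" where "H = (\<lambda>(\<omega>, y). indicator A \<omega> * indicator B (\<Phi> t (\<theta> (- t) \<omega>) y))"
  have H[measurable]: "H \<in> borel_measurable (\<F> (- t) 0 \<Otimes>\<^sub>M borel)"
  proof -
    have [measurable]: "(\<lambda>(\<omega>, x). \<Phi> t (\<theta> (- t) \<omega>) x) \<in> \<F> (- t) 0 \<Otimes>\<^sub>M borel \<rightarrow>\<^sub>M borel"
      using Phi_theta_F_measurable[OF t, of "- t"] by simp
    note [measurable] = A B
    show ?thesis unfolding H_def by measurable
  qed
  have Hm: "(\<lambda>x. H (\<omega>, x)) \<in> borel_measurable (\<rho> s)" if "\<omega> \<in> space P" for \<omega> s
  proof -
    have "(\<lambda>x. H (\<omega>, x)) \<in> borel_measurable borel"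
      by (rule measurable_compose[OF measurable_Pair1' H]) (use that space_F[of "- t" 0] t in simp)
    then show ?thesis using prob_algebraD(2)[OF rho_prob_algebra] by (simp cong: measurable_cong_sets)
  qed
  have co: "AE \<omega> in P. \<forall>x. \<Phi> (t + \<tau>) (\<theta> (- (t + \<tau>)) \<omega>) x = \<Phi> t (\<theta> (- t) \<omega>) (\<Phi> \<tau> (\<theta> (- (t + \<tau>)) \<omega>) x)"
    using AE_cocycle_theta[of \<tau> t "- (t + \<tau>)"] t tau_pos by simp
  have "(\<integral>\<^sup>+\<omega>. indicator A \<omega> * emeasure (pullback (t + \<tau>) \<omega>) B \<partial>P)
      = (\<integral>\<^sup>+\<omega>. \<integral>\<^sup>+x. H (\<omega>, \<Phi> (- t - - (t + \<tau>)) (\<theta> (- (t + \<tau>)) \<omega>) x) \<partial>\<rho> 0 \<partial>P)"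
  proof (rule nn_integral_cong_AE)
    show "AE \<omega> in P. indicator A \<omega> * emeasure (pullback (t + \<tau>) \<omega>) B
      = (\<integral>\<^sup>+x. H (\<omega>, \<Phi> (- t - - (t + \<tau>)) (\<theta> (- (t + \<tau>)) \<omega>) x) \<partial>\<rho> 0)"
      using co AE_space
    proof eventually_elim
      fix \<omega> assume c: "\<forall>x. \<Phi> (t + \<tau>) (\<theta> (- (t + \<tau>)) \<omega>) x = \<Phi> t (\<theta> (- t) \<omega>) (\<Phi> \<tau> (\<theta> (- (t + \<tau>)) \<omega>) x)"
        and \<omega>: "\<omega> \<in> space P"
      have "(\<integral>\<^sup>+x. H (\<omega>, \<Phi> (- t - - (t + \<tau>)) (\<theta> (- (t + \<tau>)) \<omega>) x) \<partial>\<rho> 0)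
        = (\<integral>\<^sup>+x. indicator A \<omega> * indicator B (\<Phi> (t + \<tau>) (\<theta> (- (t + \<tau>)) \<omega>) x) \<partial>\<rho> 0)"
        using c by (simp add: H_def)
      also have "\<dots> = indicator A \<omega> * emeasure (pullback (t + \<tau>) \<omega>) B"
        unfolding em[OF \<omega> t'] by (cases "\<omega> \<in> A") auto
      finally show "indicator A \<omega> * emeasure (pullback (t + \<tau>) \<omega>) B
        = (\<integral>\<^sup>+x. H (\<omega>, \<Phi> (- t - - (t + \<tau>)) (\<theta> (- (t + \<tau>)) \<omega>) x) \<partial>\<rho> 0)" ..
    qed
  qed
  also have "\<dots> = (\<integral>\<^sup>+\<omega>. \<integral>\<^sup>+y. H (\<omega>, y) \<partial>distr (P \<Otimes>\<^sub>M \<rho> 0) borel (\<lambda>(\<omega>, x). \<Phi> (- t - - (t + \<tau>)) (\<theta> (- (t + \<tau>)) \<omega>) x) \<partial>P)"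
    using t tau_pos by (intro nn_integral_push_forward[where c=0] rho_prob_algebra H) auto
  also have "\<dots> = (\<integral>\<^sup>+\<omega>. \<integral>\<^sup>+y. H (\<omega>, y) \<partial>\<rho> 0 \<partial>P)"
    using distr_Phi_rho[of \<tau> 0 "- (t + \<tau>)"] tau_pos rho_periodic[of 0] by simp
  also have "\<dots> = (\<integral>\<^sup>+\<omega>. indicator A \<omega> * emeasure (pullback t \<omega>) B \<partial>P)"
  proof (rule nn_integral_cong)
    fix \<omega> assume \<omega>: "\<omega> \<in> space P"
    show "(\<integral>\<^sup>+y. H (\<omega>, y) \<partial>\<rho> 0) = indicator A \<omega> * emeasure (pullback t \<omega>) B"
      unfolding em[OF \<omega> t] H_def by (cases "\<omega> \<in> A") auto
  qed
  finally have eq: "(\<integral>\<^sup>+\<omega>. indicator A \<omega> * emeasure (pullback (t + \<tau>) \<omega>) B \<partial>P)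
    = (\<integral>\<^sup>+\<omega>. indicator A \<omega> * emeasure (pullback t \<omega>) B \<partial>P)" .
  have conv: "(\<integral>\<omega>\<in>A. measure (pullback t \<omega>) B \<partial>P) = enn2real (\<integral>\<^sup>+\<omega>. indicator A \<omega> * emeasure (pullback t \<omega>) B \<partial>P)"
    if t: "0 \<le> t" for t
  proof -
    have [measurable]: "(\<lambda>\<omega>. measure (pullback t \<omega>) B) \<in> borel_measurable P"
      by (rule measurable_compose[OF pullback_measurable[OF t] measurable_measure_prob_algebra[OF B]])
    have "(\<integral>\<omega>\<in>A. measure (pullback t \<omega>) B \<partial>P) = enn2real (\<integral>\<^sup>+\<omega>. ennreal (indicator A \<omega> * measure (pullback t \<omega>) B) \<partial>P)"
      unfolding set_lebesgue_integral_def using AP by (simp add: integral_eq_nn_integral)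
    also have "(\<integral>\<^sup>+\<omega>. ennreal (indicator A \<omega> * measure (pullback t \<omega>) B) \<partial>P) = (\<integral>\<^sup>+\<omega>. indicator A \<omega> * emeasure (pullback t \<omega>) B \<partial>P)"
      using pr[OF _ t]
      by (intro nn_integral_cong)
        (auto simp: indicator_def finite_measure.emeasure_eq_measure[OF prob_space.finite_measure])
    finally show ?thesis .
  qed
  show ?thesis unfolding conv[OF t] conv[OF t'] eq ..
qed

lemma pullback_AE_convergent:
  assumes t: "0 \<le> t" and B: "B \<in> sets borel"
  shows "AE \<omega> in P. convergent (\<lambda>n. measure (pullback (real n * \<tau> + t) \<omega>) B)"
proof -
  have tn: "0 \<le> real n * \<tau> + t" for n using t tau_pos by simp
  have tS: "real (Suc n) * \<tau> + t = (real n * \<tau> + t) + \<tau>" for n by (simp add: algebra_simps)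
  interpret bounded_martingale P "\<lambda>n. \<F> (- (real n * \<tau> + t)) 0" "\<lambda>n \<omega>. measure (pullback (real n * \<tau> + t) \<omega>) B" 1
  proof
    show "subalgebra P (\<F> (- (real n * \<tau> + t)) 0)" for n
      using tn[of n] by (intro F_subalgebra) simp
    show "sets (\<F> (- (real n * \<tau> + t)) 0) \<subseteq> sets (\<F> (- (real (Suc n) * \<tau> + t)) 0)" for n
      unfolding tS using tn[of n] tau_pos by (intro F_mono) auto
    show "(\<lambda>\<omega>. measure (pullback (real n * \<tau> + t) \<omega>) B) \<in> borel_measurable (\<F> (- (real n * \<tau> + t)) 0)" for n
      by (rule measurable_compose[OF pullback_F_measurable[OF tn] measurable_measure_prob_algebra[OF B]])
    show "\<bar>measure (pullback (real n * \<tau> + t) \<omega>) B\<bar> \<le> 1" if "\<omega> \<in> space P" for n \<omega>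
      using prob_space.prob_le_1[OF prob_algebraD(1)[OF measurable_space[OF pullback_measurable[OF tn] that]]]
      by simp
    show "(\<integral>\<omega>\<in>A. measure (pullback (real (Suc n) * \<tau> + t) \<omega>) B \<partial>P) = (\<integral>\<omega>\<in>A. measure (pullback (real n * \<tau> + t) \<omega>) B \<partial>P)"
      if "A \<in> sets (\<F> (- (real n * \<tau> + t)) 0)" for n A
      unfolding tS using that by (intro pullback_martingale[OF tn _ B])
  qed
  show ?thesis by (rule AE_convergent)
qed

end

section \<open>Tightness, the limit kernel and its invariance\<close>

context markovian_rds_periodic_measure
begin

lemma pullback_prob_algebra:
  assumes "0 \<le> t" "\<omega> \<in> space P"
  shows "pullback t \<omega> \<in> space (prob_algebra borel)"
  using measurable_space[OF pullback_measurable[OF assms(1)] assms(2)] .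

text \<open>The compact sets come from a fixed sequence \<open>K m\<close>; only the choice of
  \<open>m\<close> depends on the path. By periodicity the mass of \<open>A - K m\<close> has the
  same mean under every pull-back, below \<open>1 / Suc m\<close>. Fatou's lemma keeps this bound
  for the lower limits, so their infimum over \<open>m\<close> has mean zero and vanishes almost
  surely.\<close>

lemma pullback_AE_tight:
  assumes t: "0 \<le> t" and A: "A \<in> sets borel"
  shows "AE \<omega> in P. \<forall>e>0. \<exists>K. compact K \<and> K \<subseteq> A \<and>
    (\<forall>\<^sub>F n in sequentially. measure (pullback (real n * \<tau> + t) \<omega>) (A - K) < e)"
proof -
  have tn: "0 \<le> real n * \<tau> + t" for n using t tau_pos by simp
  note \<rho> = prob_algebraD[OF rho_prob_algebra]
  interpret \<rho>t: prob_space "\<rho> t" by (rule \<rho>)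
  have "\<exists>K. compact K \<and> K \<subseteq> A \<and> measure (\<rho> t) (A - K) < 1 / real (Suc m)" for m
    by (rule inner_regular_compact[OF rho_prob_algebra A, of "1 / real (Suc m)"]) auto
  then obtain K where K: "\<And>m. compact (K m)" "\<And>m. K m \<subseteq> A" "\<And>m. measure (\<rho> t) (A - K m) < 1 / real (Suc m)"
    by metis
  have AK: "A - K m \<in> sets borel" for m
  proof -
    have "K m \<in> sets borel" by (intro borel_closed compact_imp_closed K(1))
    then show ?thesis using A by simp
  qed
  have meas: "(\<lambda>\<omega>. ennreal (measure (pullback (real n * \<tau> + t) \<omega>) (A - K m))) \<in> borel_measurable P" for n m
    by (intro measurable_compose[OF measurable_compose[OF pullback_measurable[OF tn] measurable_measure_prob_algebra[OF AK]]])
      simp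
  define Y where "Y m \<omega> = liminf (\<lambda>n. ennreal (measure (pullback (real n * \<tau> + t) \<omega>) (A - K m)))" for m \<omega>
  have Ym: "Y m \<in> borel_measurable P" for m
    unfolding Y_def using meas by measurable
  have Yint: "(\<integral>\<^sup>+\<omega>. Y m \<omega> \<partial>P) \<le> ennreal (1 / real (Suc m))" for m
  proof -
    have "(\<integral>\<^sup>+\<omega>. Y m \<omega> \<partial>P)
        \<le> liminf (\<lambda>n. \<integral>\<^sup>+\<omega>. ennreal (measure (pullback (real n * \<tau> + t) \<omega>) (A - K m)) \<partial>P)"
      unfolding Y_def by (rule nn_integral_liminf) (rule meas)
    also have "(\<lambda>n. \<integral>\<^sup>+\<omega>. ennreal (measure (pullback (real n * \<tau> + t) \<omega>) (A - K m)) \<partial>P)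
        = (\<lambda>n. ennreal (measure (\<rho> t) (A - K m)))"
    proof
      fix n
      have "(\<lambda>\<omega>. measure (pullback (real n * \<tau> + t) \<omega>) (A - K m)) \<in> borel_measurable P"
        by (rule measurable_compose[OF pullback_measurable[OF tn] measurable_measure_prob_algebra[OF AK]])
      then have "integrable P (\<lambda>\<omega>. measure (pullback (real n * \<tau> + t) \<omega>) (A - K m))"
        using prob_space.prob_le_1[OF prob_algebraD(1)[OF pullback_prob_algebra[OF tn]]]
        by (intro integrable_const_bound[where B=1]) auto
      then have "(\<integral>\<^sup>+\<omega>. ennreal (measure (pullback (real n * \<tau> + t) \<omega>) (A - K m)) \<partial>P)
        = ennreal (\<integral>\<omega>. measure (pullback (real n * \<tau> + t) \<omega>) (A - K m) \<partial>P)"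
        by (intro nn_integral_eq_integral) auto
      then show "(\<integral>\<^sup>+\<omega>. ennreal (measure (pullback (real n * \<tau> + t) \<omega>) (A - K m)) \<partial>P)
        = ennreal (measure (\<rho> t) (A - K m))"
        by (simp add: pullback_mean_set[OF tn AK] rho_periodic_nat)
    qed
    also have "liminf (\<lambda>n::nat. ennreal (measure (\<rho> t) (A - K m))) = ennreal (measure (\<rho> t) (A - K m))"
      by (simp add: Liminf_const)
    also have "\<dots> \<le> ennreal (1 / real (Suc m))"
      using K(3)[of m] by (intro ennreal_leI) simp
    finally show ?thesis .
  qed
  have "(\<integral>\<^sup>+\<omega>. (INF m. Y m \<omega>) \<partial>P) = 0"
  proof -
    have "(\<integral>\<^sup>+\<omega>. (INF m. Y m \<omega>) \<partial>P) \<le> ennreal (1 / real (Suc m))" for m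
      by (rule order_trans[OF nn_integral_mono Yint]) (auto intro: INF_lower)
    moreover have "(\<lambda>m. ennreal (1 / real (Suc m))) \<longlonglongrightarrow> 0"
      using tendsto_ennrealI[OF LIMSEQ_Suc[OF lim_1_over_n]] by simp
    ultimately have "(\<integral>\<^sup>+\<omega>. (INF m. Y m \<omega>) \<partial>P) \<le> 0"
      by (intro LIMSEQ_le_const) auto
    then show ?thesis by simp
  qed
  then have Y0: "AE \<omega> in P. (INF m. Y m \<omega>) = 0"
    using Ym by (subst (asm) nn_integral_0_iff_AE) auto
  \<comment> \<open>Fatou's lemma controls lower limits only, that is, a subsequence depending on
    the path. Martingale convergence on the countably many sets \<open>A - K m\<close> makes them
    limits, hence bounds for all large \<open>n\<close>.\<close>
  have "AE \<omega> in P. \<forall>m. convergent (\<lambda>n. measure (pullback (real n * \<tau> + t) \<omega>) (A - K m))"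
    unfolding AE_all_countable using pullback_AE_convergent[OF t AK] by blast
  with Y0 show ?thesis
  proof eventually_elim
    fix \<omega> assume Y0: "(INF m. Y m \<omega>) = 0"
      and conv: "\<forall>m. convergent (\<lambda>n. measure (pullback (real n * \<tau> + t) \<omega>) (A - K m))"
    show "\<forall>e>0. \<exists>K. compact K \<and> K \<subseteq> A \<and>
      (\<forall>\<^sub>F n in sequentially. measure (pullback (real n * \<tau> + t) \<omega>) (A - K) < e)"
    proof (intro allI impI)
      fix e :: real assume e: "0 < e"
      then have "(INF m. Y m \<omega>) < ennreal e" using Y0 by simp
      then obtain m where m: "Y m \<omega> < ennreal e" by (auto simp: INF_less_iff)
      obtain l where l: "(\<lambda>n. measure (pullback (real n * \<tau> + t) \<omega>) (A - K m)) \<longlonglongrightarrow> l"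
        using conv by (auto simp: convergent_def)
      have l0: "0 \<le> l" by (rule LIMSEQ_le_const[OF l]) auto
      have "Y m \<omega> = ennreal l"
        unfolding Y_def using tendsto_ennrealI[OF l] by (intro lim_imp_Liminf) auto
      then have "l < e" using m l0 by (simp add: ennreal_less_iff)
      then have "\<forall>\<^sub>F n in sequentially. measure (pullback (real n * \<tau> + t) \<omega>) (A - K m) < e"
        by (rule order_tendstoD(2)[OF l])
      then show "\<exists>K. compact K \<and> K \<subseteq> A \<and>
        (\<forall>\<^sub>F n in sequentially. measure (pullback (real n * \<tau> + t) \<omega>) (A - K) < e)"
        using K(1,2) by blast
    qed
  qed
qed

text \<open>The limit measure is picked separately for each path, yet the result is measurable: its
  masses on the generating algebra are forced to be limits of measurable functions. The algebra is a
  parameter so that convergence on it remains available beside weak convergence.\<close>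

lemma pullback_limit_exists:
  assumes t: "0 \<le> t"
    and \<A>: "countable \<A>" "algebra UNIV \<A>" "sets borel = sigma_sets UNIV \<A>"
      "\<And>W. open W \<Longrightarrow> \<exists>I. range I \<subseteq> \<A> \<and> incseq I \<and> W = (\<Union>n::nat. I n)"
  obtains \<kappa> where "\<kappa> \<in> P \<rightarrow>\<^sub>M prob_algebra borel"
    "AE \<omega> in P. \<forall>A\<in>\<A>. (\<lambda>n. measure (pullback (real n * \<tau> + t) \<omega>) A) \<longlonglongrightarrow> measure (\<kappa> \<omega>) A"
    "AE \<omega> in P. weakly_converges_to (\<lambda>n. pullback (real n * \<tau> + t) \<omega>) (\<kappa> \<omega>)"
proof -
  interpret \<A>: algebra UNIV \<A> by fact
  have tn: "0 \<le> real n * \<tau> + t" for n using t tau_pos by simp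
  have AB: "A \<in> sets borel" if "A \<in> \<A>" for A using that \<A>(3) by auto
  define good where "good \<omega> L \<longleftrightarrow> L \<in> space (prob_algebra borel) \<and>
    (\<forall>A\<in>\<A>. (\<lambda>n. measure (pullback (real n * \<tau> + t) \<omega>) A) \<longlonglongrightarrow> measure L A)" for \<omega> and L :: "'x measure"
  have "AE \<omega> in P. \<forall>A\<in>\<A>. convergent (\<lambda>n. measure (pullback (real n * \<tau> + t) \<omega>) A)"
    using \<A>(1) AB pullback_AE_convergent[OF t] by (subst AE_ball_countable) auto
  moreover have "AE \<omega> in P. \<forall>A\<in>\<A>. \<forall>e>0. \<exists>K. compact K \<and> K \<subseteq> A \<and>
      (\<forall>\<^sub>F n in sequentially. measure (pullback (real n * \<tau> + t) \<omega>) (A - K) < e)"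
    using \<A>(1) AB pullback_AE_tight[OF t] by (subst AE_ball_countable) auto
  ultimately have "AE \<omega> in P. \<exists>L. good \<omega> L"
    using AE_space
  proof eventually_elim
    case (elim \<omega>)
    have "\<exists>L\<in>space (prob_algebra borel). \<forall>A\<in>\<A>. (\<lambda>n. measure (pullback (real n * \<tau> + t) \<omega>) A) \<longlonglongrightarrow> measure L A"
      by (rule limit_measure_exists[OF \<A>(2,3) pullback_prob_algebra[OF tn elim(3)]]) (use elim in auto)
    then show ?case unfolding good_def by blast
  qed
  then obtain N where N: "\<And>\<omega>. \<omega> \<in> space P - N \<Longrightarrow> \<exists>L. good \<omega> L" "N \<in> null_sets P"
    by (rule AE_E3) blast
  \<comment> \<open>On the null set any fixed probability law will do, here \<open>\<rho> t\<close>;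
    a kernel must take probability measures as values everywhere.\<close>
  define \<kappa> where "\<kappa> \<omega> = (if \<omega> \<in> N then \<rho> t else SOME L. good \<omega> L)" for \<omega>
  have \<kappa>_good: "good \<omega> (\<kappa> \<omega>)" if "\<omega> \<in> space P - N" for \<omega>
    using someI_ex[OF N(1)[OF that]] that by (simp add: \<kappa>_def)
  have \<kappa>_prob: "\<kappa> \<omega> \<in> space (prob_algebra borel)" if "\<omega> \<in> space P" for \<omega>
    using \<kappa>_good[of \<omega>] that rho_prob_algebra by (cases "\<omega> \<in> N") (auto simp: \<kappa>_def good_def)
  have NM[measurable]: "N \<in> sets P" using N(2) by auto
  have "\<kappa> \<in> P \<rightarrow>\<^sub>M prob_algebra borel"
  proof (rule measurable_prob_algebra_generated[OF \<A>(3)])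
    show "Int_stable \<A>" by (auto simp: Int_stable_def)
    fix A assume A: "A \<in> \<A>"
    have [measurable]: "(\<lambda>\<omega>. measure (pullback (real n * \<tau> + t) \<omega>) A) \<in> borel_measurable P" for n
      by (rule measurable_compose[OF pullback_measurable[OF tn] measurable_measure_prob_algebra[OF AB[OF A]]])
    have "(\<lambda>\<omega>. measure (\<kappa> \<omega>) A) \<in> borel_measurable P"
    \<comment> \<open>This rule asks for convergence at every point, so the approximating masses are
      overwritten by the default value on \<open>N\<close>.\<close>
    proof (rule borel_measurable_LIMSEQ_real)
      show "(\<lambda>\<omega>. if \<omega> \<in> N then measure (\<rho> t) A else measure (pullback (real n * \<tau> + t) \<omega>) A) \<in> borel_measurable P" for n
        by measurable
      show "(\<lambda>n. if \<omega> \<in> N then measure (\<rho> t) A else measure (pullback (real n * \<tau> + t) \<omega>) A) \<longlonglongrightarrow> measure (\<kappa> \<omega>) A"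
        if "\<omega> \<in> space P" for \<omega>
        using \<kappa>_good[of \<omega>] that A by (cases "\<omega> \<in> N") (auto simp: \<kappa>_def good_def)
    qed
    then have "(\<lambda>\<omega>. ennreal (measure (\<kappa> \<omega>) A)) \<in> borel_measurable P" by measurable
    then show "(\<lambda>\<omega>. emeasure (\<kappa> \<omega>) A) \<in> borel_measurable P"
      by (rule measurable_cong[THEN iffD1, rotated])
        (simp add: finite_measure.emeasure_eq_measure[OF prob_space.finite_measure[OF prob_algebraD(1)[OF \<kappa>_prob]]])
  qed (use \<kappa>_prob in \<open>auto simp: space_prob_algebra\<close>)
  moreover have AEN: "AE \<omega> in P. \<omega> \<in> space P - N"
    using AE_not_in[OF N(2)] AE_space by eventually_elim simp
  then have "AE \<omega> in P. \<forall>A\<in>\<A>. (\<lambda>n. measure (pullback (real n * \<tau> + t) \<omega>) A) \<longlonglongrightarrow> measure (\<kappa> \<omega>) A"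
    by eventually_elim (use \<kappa>_good in \<open>auto simp: good_def\<close>)
  moreover have "AE \<omega> in P. weakly_converges_to (\<lambda>n. pullback (real n * \<tau> + t) \<omega>) (\<kappa> \<omega>)"
    using AEN
  proof eventually_elim
    case (elim \<omega>)
    then show ?case
      using \<kappa>_good[OF elim] pullback_prob_algebra[OF tn] \<A>(4) AB unfolding good_def
      by (intro weakly_converges_to_if_algebra[where \<A>=\<A>]) auto
  qed
  ultimately show ?thesis using that by blast
qed

text \<open>Weak convergence to \<open>\<kappa>\<close> alone says nothing about masses of general
  Borel sets. Uniqueness of weak limits identifies \<open>\<kappa>\<close> almost surely with the
  constructed kernel, which comes with convergence on a generating algebra;
  \<open>pullback_mean\<close> supplies the constant means.\<close>

lemma pullback_L1_convergence:
  assumes t: "0 \<le> t"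
    and \<kappa>: "\<kappa> \<in> P \<rightarrow>\<^sub>M prob_algebra borel"
      "AE \<omega> in P. weakly_converges_to (\<lambda>n. pullback (real n * \<tau> + t) \<omega>) (\<kappa> \<omega>)"
    and c: "0 \<le> c" and D: "D \<in> sets (\<F> 0 c \<Otimes>\<^sub>M borel)"
  shows "(\<lambda>n. \<integral>\<omega>. \<bar>measure (pullback (real n * \<tau> + t) \<omega>) (Pair \<omega> -` D) - measure (\<kappa> \<omega>) (Pair \<omega> -` D)\<bar> \<partial>P)
    \<longlonglongrightarrow> 0"
proof -
  have tn: "0 \<le> real n * \<tau> + t" for n using t tau_pos by simp
  obtain \<A> :: "'x set set" where \<A>: "countable \<A>" "algebra UNIV \<A>" "sets borel = sigma_sets UNIV \<A>"
      "\<And>W. open W \<Longrightarrow> \<exists>I. range I \<subseteq> \<A> \<and> incseq I \<and> W = (\<Union>n::nat. I n)"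
    by (rule countable_generating_algebra) blast
  obtain \<kappa>' where \<kappa>': "\<kappa>' \<in> P \<rightarrow>\<^sub>M prob_algebra borel"
    "AE \<omega> in P. \<forall>A\<in>\<A>. (\<lambda>n. measure (pullback (real n * \<tau> + t) \<omega>) A) \<longlonglongrightarrow> measure (\<kappa>' \<omega>) A"
    "AE \<omega> in P. weakly_converges_to (\<lambda>n. pullback (real n * \<tau> + t) \<omega>) (\<kappa>' \<omega>)"
    by (rule pullback_limit_exists[OF t \<A>]) blast
  have "AE \<omega> in P. \<kappa> \<omega> = \<kappa>' \<omega>"
    using \<kappa>(2) \<kappa>'(3) AE_space
  proof eventually_elim
    case (elim \<omega>)
    then show ?case
      using prob_algebraD[OF measurable_space[OF \<kappa>(1) elim(3)]] prob_algebraD[OF measurable_space[OF \<kappa>'(1) elim(3)]]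
      by (intro weakly_converges_to_unique[OF elim(1,2)]) (auto intro: prob_space.finite_measure)
  qed
  with \<kappa>'(2) have lim: "AE \<omega> in P. \<forall>A\<in>\<A>. (\<lambda>n. measure (pullback (real n * \<tau> + t) \<omega>) A) \<longlonglongrightarrow> measure (\<kappa> \<omega>) A"
    by eventually_elim simp
  show ?thesis
  proof (rule kernel_L1_convergence[where F="\<F> 0 c" and \<sigma>="\<lambda>_. \<rho> t" and N=borel and \<A>=\<A>])
    show "AE \<omega> in P. (\<lambda>n. measure (pullback (real n * \<tau> + t) \<omega>) A) \<longlonglongrightarrow> measure (\<kappa> \<omega>) A" if "A \<in> \<A>" for A
      using lim by eventually_elim (use that in blast)
    show "(\<integral>\<omega>. measure (pullback (real n * \<tau> + t) \<omega>) (Pair \<omega> -` D) \<partial>P) = (\<integral>\<omega>. measure (\<rho> t) (Pair \<omega> -` D) \<partial>P)"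
      if "D \<in> sets (\<F> 0 c \<Otimes>\<^sub>M borel)" for n D
      using pullback_mean[OF tn c that, of n] by (simp add: rho_periodic_nat)
  qed (use \<A> \<kappa>(1) D c rho_prob_algebra in \<open>auto intro: F_subalgebra pullback_measurable[OF tn]\<close>)
qed

text \<open>Every pull-back in the sequence has mean \<open>\<rho> t\<close>, and convergence in
  mean on the cylinder over \<open>B\<close> carries this to the limit.\<close>

lemma pullback_limit_mean:
  assumes t: "0 \<le> t"
    and \<kappa>: "\<kappa> \<in> P \<rightarrow>\<^sub>M prob_algebra borel"
      "AE \<omega> in P. weakly_converges_to (\<lambda>n. pullback (real n * \<tau> + t) \<omega>) (\<kappa> \<omega>)"
    and B: "B \<in> sets borel"
  shows "(\<integral>\<omega>. measure (\<kappa> \<omega>) B \<partial>P) = measure (\<rho> t) B"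
proof -
  have tn: "0 \<le> real n * \<tau> + t" for n using t tau_pos by simp
  have D: "space P \<times> B \<in> sets (\<F> 0 0 \<Otimes>\<^sub>M borel)"
    using B space_F[of 0 0] sets.top[of "\<F> 0 0"] by (intro pair_measureI) auto
  have int: "integrable P (\<lambda>\<omega>. measure (K \<omega>) B)" if K: "K \<in> P \<rightarrow>\<^sub>M prob_algebra borel" for K
    using measurable_compose[OF K measurable_measure_prob_algebra[OF B]]
      prob_space.prob_le_1[OF prob_algebraD(1)[OF measurable_space[OF K]]]
    by (intro integrable_const_bound[where B=1]) auto
  have "(\<lambda>n. \<integral>\<omega>. \<bar>measure (pullback (real n * \<tau> + t) \<omega>) (Pair \<omega> -` (space P \<times> B)) - measure (\<kappa> \<omega>) (Pair \<omega> -` (space P \<times> B))\<bar> \<partial>P)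
    \<longlonglongrightarrow> 0"
    by (rule pullback_L1_convergence[OF t \<kappa> order_refl D])
  also have "(\<lambda>n. \<integral>\<omega>. \<bar>measure (pullback (real n * \<tau> + t) \<omega>) (Pair \<omega> -` (space P \<times> B)) - measure (\<kappa> \<omega>) (Pair \<omega> -` (space P \<times> B))\<bar> \<partial>P)
    = (\<lambda>n. \<integral>\<omega>. \<bar>measure (pullback (real n * \<tau> + t) \<omega>) B - measure (\<kappa> \<omega>) B\<bar> \<partial>P)"
    by (intro ext Bochner_Integration.integral_cong) auto
  finally have lim: "(\<lambda>n. \<integral>\<omega>. \<bar>measure (pullback (real n * \<tau> + t) \<omega>) B - measure (\<kappa> \<omega>) B\<bar> \<partial>P) \<longlonglongrightarrow> 0" .
  have "\<bar>measure (\<rho> t) B - (\<integral>\<omega>. measure (\<kappa> \<omega>) B \<partial>P)\<bar>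
      \<le> (\<integral>\<omega>. \<bar>measure (pullback (real n * \<tau> + t) \<omega>) B - measure (\<kappa> \<omega>) B\<bar> \<partial>P)" for n
  proof -
    have "measure (\<rho> t) B - (\<integral>\<omega>. measure (\<kappa> \<omega>) B \<partial>P)
        = (\<integral>\<omega>. measure (pullback (real n * \<tau> + t) \<omega>) B - measure (\<kappa> \<omega>) B \<partial>P)"
      using int[OF pullback_measurable[OF tn]] int[OF \<kappa>(1)] pullback_mean_set[OF tn B, of n]
      by (simp add: rho_periodic_nat)
    then show ?thesis
      using integral_abs_bound[of P "\<lambda>\<omega>. measure (pullback (real n * \<tau> + t) \<omega>) B - measure (\<kappa> \<omega>) B"] by simp
  qed
  then have "\<bar>measure (\<rho> t) B - (\<integral>\<omega>. measure (\<kappa> \<omega>) B \<partial>P)\<bar> \<le> 0"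
    by (intro LIMSEQ_le_const[OF lim]) auto
  then show ?thesis by simp
qed

text \<open>
  \<open>\<Phi> u \<omega>\<close> need not be continuous, so it cannot be pushed through the weak limit pathwise. Instead both
  sides are compared in mean on the random set where \<open>\<Phi> u \<omega> x \<in> A\<close>, which is \<open>\<F> 0 u\<close>-measurable
  and hence covered by \<open>pullback_L1_convergence\<close>.
\<close>

lemma pullback_limit_invariant:
  assumes t: "0 \<le> t" and u: "0 \<le> u"
    and \<kappa>: "\<kappa> \<in> P \<rightarrow>\<^sub>M prob_algebra borel"
      "AE \<omega> in P. weakly_converges_to (\<lambda>n. pullback (real n * \<tau> + t) \<omega>) (\<kappa> \<omega>)"
    and \<kappa>': "\<kappa>' \<in> P \<rightarrow>\<^sub>M prob_algebra borel"
      "AE \<omega> in P. weakly_converges_to (\<lambda>n. pullback (real n * \<tau> + (u + t)) \<omega>) (\<kappa>' \<omega>)"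
  shows "AE \<omega> in P. distr (\<kappa> \<omega>) borel (\<Phi> u \<omega>) = \<kappa>' (\<theta> u \<omega>)"
proof -
  have tn: "0 \<le> real n * \<tau> + t" for n using t tau_pos by simp
  have tn': "0 \<le> real n * \<tau> + (u + t)" for n using t u tau_pos by simp
  have ut: "0 \<le> u + t" using t u by simp
  \<comment> \<open>On both sides \<open>\<rho> 0\<close> starts at time \<open>- r\<close> of the
    noise path \<open>\<omega>\<close>, with \<open>r\<close> the running time of the shorter
    pull-back. Observing at time \<open>u\<close> is observing at time 0 and then applying
    \<open>\<Phi> u \<omega>\<close>.\<close>
  have cocycle: "AE \<omega> in P. pullback (real n * \<tau> + (u + t)) (\<theta> u \<omega>)
      = distr (pullback (real n * \<tau> + t) \<omega>) borel (\<Phi> u \<omega>)" for n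
  proof -
    define r where "r = real n * \<tau> + t"
    have r: "0 \<le> r" using tn by (simp add: r_def)
    have eq: "real n * \<tau> + (u + t) = u + r" by (simp add: r_def)
    have "AE \<omega> in P. \<forall>x. \<Phi> (u + r) (\<theta> (- r) \<omega>) x = \<Phi> u (\<theta> (r + - r) \<omega>) (\<Phi> r (\<theta> (- r) \<omega>) x)"
      by (rule AE_cocycle_theta[OF r u])
    then show ?thesis
      unfolding eq r_def[symmetric] using AE_space
    proof eventually_elim
      case (elim \<omega>)
      have "\<theta> (- (u + r)) (\<theta> u \<omega>) = \<theta> (- r) \<omega>"
        using theta_add[OF elim(2), of "- (u + r)" u] by simp
      moreover have "\<Phi> (u + r) (\<theta> (- r) \<omega>) = \<Phi> u \<omega> \<circ> \<Phi> r (\<theta> (- r) \<omega>)"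
        using elim by (simp add: fun_eq_iff theta_0)
      moreover have "\<Phi> r (\<theta> (- r) \<omega>) \<in> \<rho> 0 \<rightarrow>\<^sub>M borel"
        using Phi_section_measurable[OF r theta_space[OF elim(2)]] prob_algebraD(2)[OF rho_prob_algebra]
        by (simp cong: measurable_cong_sets)
      ultimately show ?case
        unfolding pullback_def using Phi_section_measurable[OF u elim(2)] by (simp add: distr_distr)
    qed
  qed
  obtain \<A> :: "'x set set" where \<A>: "countable \<A>" "algebra UNIV \<A>" "sets borel = sigma_sets UNIV \<A>"
    by (rule countable_generating_algebra) blast
  interpret \<A>: algebra UNIV \<A> by fact
  \<comment> \<open>One set at a time, with its own null set; countability of \<open>\<A>\<close>
    joins these null sets at the end.\<close>
  have "AE \<omega> in P. measure (distr (\<kappa> \<omega>) borel (\<Phi> u \<omega>)) A = measure (\<kappa>' (\<theta> u \<omega>)) A" if A: "A \<in> \<A>" for A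
  proof -
    have AB: "A \<in> sets borel" using A \<A>(3) by auto
    define D where "D = (\<lambda>(\<omega>, x). \<Phi> u \<omega> x) -` A \<inter> space (\<F> 0 u \<Otimes>\<^sub>M borel)"
    have D: "D \<in> sets (\<F> 0 u \<Otimes>\<^sub>M borel)"
      unfolding D_def using Phi_adapted[OF u] AB by (rule measurable_sets)
    have DP: "D \<in> sets (P \<Otimes>\<^sub>M borel)"
      using subalgebra_pair_sets[OF F_subalgebra[OF u]] D by auto
    have D': "space P \<times> A \<in> sets (\<F> 0 0 \<Otimes>\<^sub>M borel)"
      using AB space_F[of 0 0] sets.top[of "\<F> 0 0"] by (intro pair_measureI) auto
    have sec: "measure (distr L borel (\<Phi> u \<omega>)) A = measure L (Pair \<omega> -` D)"
      if "L \<in> space (prob_algebra borel)" "\<omega> \<in> space P" for L \<omega>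
    proof -
      have "\<Phi> u \<omega> \<in> L \<rightarrow>\<^sub>M borel"
        using Phi_section_measurable[OF u that(2)] prob_algebraD(2)[OF that(1)] by (simp cong: measurable_cong_sets)
      moreover have "\<Phi> u \<omega> -` A \<inter> space L = Pair \<omega> -` D"
        using prob_algebraD(3)[OF that(1)] that(2) space_F[OF u] by (auto simp: D_def space_pair_measure)
      ultimately show ?thesis using AB by (simp add: measure_distr)
    qed
    have km: "(\<lambda>\<omega>. measure (K \<omega>) A) \<in> borel_measurable P" if "K \<in> P \<rightarrow>\<^sub>M prob_algebra borel" for K
      by (rule measurable_compose[OF that measurable_measure_prob_algebra[OF AB]])
    note kD = kernel_section_measurable[OF _ DP]
    define e1 where "e1 n \<omega> = \<bar>measure (pullback (real n * \<tau> + t) \<omega>) (Pair \<omega> -` D) - measure (\<kappa> \<omega>) (Pair \<omega> -` D)\<bar>" for n \<omega>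
    define e2 where "e2 n \<omega> = \<bar>measure (pullback (real n * \<tau> + (u + t)) \<omega>) A - measure (\<kappa>' \<omega>) A\<bar>" for n \<omega>
    have le1: "measure (K \<omega>) X \<le> 1" if "K \<in> P \<rightarrow>\<^sub>M prob_algebra borel" "\<omega> \<in> space P" for K \<omega> and X :: "'x set"
      using prob_space.prob_le_1[OF prob_algebraD(1)[OF measurable_space[OF that]]] .
    have intD: "integrable P (\<lambda>\<omega>. measure (K \<omega>) (Pair \<omega> -` D))" if "K \<in> P \<rightarrow>\<^sub>M prob_algebra borel" for K
      using le1[OF that] by (intro integrable_const_bound[where B=1] kD that) auto
    have intA: "integrable P (\<lambda>\<omega>. measure (K \<omega>) A)" if "K \<in> P \<rightarrow>\<^sub>M prob_algebra borel" for K
      using le1[OF that] by (intro integrable_const_bound[where B=1] km that) auto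
    have e1_int: "integrable P (e1 n)" for n
      unfolding e1_def by (intro integrable_abs Bochner_Integration.integrable_diff intD pullback_measurable tn \<kappa>)
    have e2_int: "integrable P (e2 n)" for n
      unfolding e2_def by (intro integrable_abs Bochner_Integration.integrable_diff intA pullback_measurable tn' \<kappa>')
    have e1_lim: "(\<lambda>n. \<integral>\<omega>. e1 n \<omega> \<partial>P) \<longlonglongrightarrow> 0"
      unfolding e1_def by (rule pullback_L1_convergence[OF t \<kappa> u D])
    have e2_lim: "(\<lambda>n. \<integral>\<omega>. e2 n \<omega> \<partial>P) \<longlonglongrightarrow> 0"
    proof -
      have "(\<integral>\<omega>. e2 n \<omega> \<partial>P) = (\<integral>\<omega>. \<bar>measure (pullback (real n * \<tau> + (u + t)) \<omega>) (Pair \<omega> -` (space P \<times> A))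
          - measure (\<kappa>' \<omega>) (Pair \<omega> -` (space P \<times> A))\<bar> \<partial>P)" for n
        unfolding e2_def by (intro Bochner_Integration.integral_cong) auto
      then show ?thesis using pullback_L1_convergence[OF ut \<kappa>' order_refl D'] by simp
    qed
    have theta_int: "integrable P (\<lambda>\<omega>. f (\<theta> u \<omega>))" "(\<integral>\<omega>. f (\<theta> u \<omega>) \<partial>P) = (\<integral>\<omega>. f \<omega> \<partial>P)"
      if f: "integrable P f" for f :: "'w \<Rightarrow> real"
    proof -
      have "integrable (distr P P (\<theta> u)) f" using f by (simp add: theta_preserving)
      then show "integrable P (\<lambda>\<omega>. f (\<theta> u \<omega>))"
        by (rule integrable_distr[OF theta_measurable])
      have "(\<integral>\<omega>. f \<omega> \<partial>distr P P (\<theta> u)) = (\<integral>\<omega>. f (\<theta> u \<omega>) \<partial>P)"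
        using f by (intro integral_distr theta_measurable) auto
      then show "(\<integral>\<omega>. f (\<theta> u \<omega>) \<partial>P) = (\<integral>\<omega>. f \<omega> \<partial>P)" by (simp add: theta_preserving)
    qed
    \<comment> \<open>\<open>g\<close> is free of \<open>n\<close>. Inserting the pull-back bounds
      it by \<open>e1 n\<close> at \<open>\<omega>\<close> plus \<open>e2 n\<close> at
      \<open>\<theta> u \<omega>\<close>; both means tend to 0, the second because
      \<open>\<theta> u\<close> preserves \<open>P\<close>.\<close>
    define g where "g \<omega> = \<bar>measure (\<kappa> \<omega>) (Pair \<omega> -` D) - measure (\<kappa>' (\<theta> u \<omega>)) A\<bar>" for \<omega>
    have g_int: "integrable P g"
      unfolding g_def
      by (intro integrable_abs Bochner_Integration.integrable_diff intD \<kappa> theta_int(1)[OF intA] \<kappa>')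
    have "(\<integral>\<omega>. g \<omega> \<partial>P) \<le> (\<integral>\<omega>. e1 n \<omega> \<partial>P) + (\<integral>\<omega>. e2 n \<omega> \<partial>P)" for n
    proof -
      have "(\<integral>\<omega>. g \<omega> \<partial>P) \<le> (\<integral>\<omega>. e1 n \<omega> + e2 n (\<theta> u \<omega>) \<partial>P)"
      proof (rule integral_mono_AE[OF g_int])
        show "integrable P (\<lambda>\<omega>. e1 n \<omega> + e2 n (\<theta> u \<omega>))"
          by (intro Bochner_Integration.integrable_add e1_int theta_int(1) e2_int)
        show "AE \<omega> in P. g \<omega> \<le> e1 n \<omega> + e2 n (\<theta> u \<omega>)"
          using cocycle[of n] AE_space
        proof eventually_elim
          case (elim \<omega>)
          have "measure (pullback (real n * \<tau> + (u + t)) (\<theta> u \<omega>)) A = measure (pullback (real n * \<tau> + t) \<omega>) (Pair \<omega> -` D)"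
            unfolding elim(1) by (rule sec[OF pullback_prob_algebra[OF tn elim(2)] elim(2)])
          then show ?case unfolding g_def e1_def e2_def by linarith
        qed
      qed
      also have "\<dots> = (\<integral>\<omega>. e1 n \<omega> \<partial>P) + (\<integral>\<omega>. e2 n \<omega> \<partial>P)"
        using e1_int theta_int[OF e2_int] by simp
      finally show ?thesis .
    qed
    then have "(\<integral>\<omega>. g \<omega> \<partial>P) \<le> 0"
      by (intro LIMSEQ_le_const[OF tendsto_add_zero[OF e1_lim e2_lim]]) auto
    moreover have "0 \<le> (\<integral>\<omega>. g \<omega> \<partial>P)" by (simp add: g_def)
    ultimately have "(\<integral>\<omega>. g \<omega> \<partial>P) = 0" by simp
    moreover have "AE \<omega> in P. 0 \<le> g \<omega>" by (simp add: g_def)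
    ultimately have "AE \<omega> in P. g \<omega> = 0"
      using integral_nonneg_eq_0_iff_AE[OF g_int] by simp
    then show ?thesis
      using AE_space
    proof eventually_elim
      case (elim \<omega>)
      then show ?case
        using sec[OF measurable_space[OF \<kappa>(1) elim(2)] elim(2)] by (simp add: g_def)
    qed
  qed
  then have "AE \<omega> in P. \<forall>A\<in>\<A>. measure (distr (\<kappa> \<omega>) borel (\<Phi> u \<omega>)) A = measure (\<kappa>' (\<theta> u \<omega>)) A"
    using \<A>(1) by (subst AE_ball_countable) auto
  then show ?thesis
    using AE_space
  proof eventually_elim
    case (elim \<omega>)
    note L = prob_algebraD[OF measurable_space[OF \<kappa>(1) elim(2)]]
    note L' = prob_algebraD[OF measurable_space[OF \<kappa>'(1) theta_space[OF elim(2)]]]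
    interpret L': prob_space "\<kappa>' (\<theta> u \<omega>)" by (rule L')
    have "\<Phi> u \<omega> \<in> \<kappa> \<omega> \<rightarrow>\<^sub>M borel"
      using Phi_section_measurable[OF u elim(2)] L(2) by (simp cong: measurable_cong_sets)
    then interpret D: prob_space "distr (\<kappa> \<omega>) borel (\<Phi> u \<omega>)"
      by (rule prob_space.prob_space_distr[OF L(1)])
    show ?case
    proof (rule measure_eqI_generator_eq[where E=\<A> and \<Omega>=UNIV and A="\<lambda>_. UNIV"])
      show "Int_stable \<A>" by (auto simp: Int_stable_def)
      show "emeasure (distr (\<kappa> \<omega>) borel (\<Phi> u \<omega>)) X = emeasure (\<kappa>' (\<theta> u \<omega>)) X" if "X \<in> \<A>" for X
        using elim(1) that by (simp add: D.emeasure_eq_measure L'.emeasure_eq_measure)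
    qed (use L' \<A>(3) in auto)
  qed
qed

end

subsection \<open>Measures on the product space\<close>

context prob_space
begin

lemma kernel_product_kernel_measurable:
  assumes "\<kappa> \<in> M \<rightarrow>\<^sub>M prob_algebra borel"
  shows "(\<lambda>\<omega>. distr (\<kappa> \<omega>) (M \<Otimes>\<^sub>M borel) (Pair \<omega>)) \<in> M \<rightarrow>\<^sub>M prob_algebra (M \<Otimes>\<^sub>M borel)"
  using assms by (intro measurable_distr_prob_space2) auto

lemma kernel_product_prob_algebra:
  assumes "\<kappa> \<in> M \<rightarrow>\<^sub>M prob_algebra borel"
  shows "kernel_product M \<kappa> \<in> space (prob_algebra (M \<Otimes>\<^sub>M borel))"
proof -
  have "M \<in> space (prob_algebra M)" by (simp add: space_prob_algebra prob_space_axioms)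
  then show ?thesis
    using kernel_product_kernel_measurable[OF assms]
    unfolding kernel_product_def by (simp add: space_prob_algebra prob_space_bind' sets_bind')
qed

lemma distr_kernel_product:
  assumes \<kappa>: "\<kappa> \<in> M \<rightarrow>\<^sub>M prob_algebra borel" and f: "f \<in> M \<Otimes>\<^sub>M borel \<rightarrow>\<^sub>M N"
  shows "distr (kernel_product M \<kappa>) N f = M \<bind> (\<lambda>\<omega>. distr (\<kappa> \<omega>) N (\<lambda>x. f (\<omega>, x)))"
proof -
  have "distr (kernel_product M \<kappa>) N f
      = M \<bind> (\<lambda>\<omega>. distr (distr (\<kappa> \<omega>) (M \<Otimes>\<^sub>M borel) (Pair \<omega>)) N f)"
    unfolding kernel_product_def
    by (rule distr_bind[OF measurable_prob_algebraD[OF kernel_product_kernel_measurable[OF \<kappa>]] not_empty f])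
  also have "\<dots> = M \<bind> (\<lambda>\<omega>. distr (\<kappa> \<omega>) N (\<lambda>x. f (\<omega>, x)))"
  proof (rule bind_cong[OF refl])
    fix \<omega> assume \<omega>: "\<omega> \<in> space M"
    have "Pair \<omega> \<in> \<kappa> \<omega> \<rightarrow>\<^sub>M M \<Otimes>\<^sub>M borel"
      using measurable_Pair1'[OF \<omega>] prob_algebraD(2)[OF measurable_space[OF \<kappa> \<omega>]]
      by (simp cong: measurable_cong_sets)
    then show "distr (distr (\<kappa> \<omega>) (M \<Otimes>\<^sub>M borel) (Pair \<omega>)) N f = distr (\<kappa> \<omega>) N (\<lambda>x. f (\<omega>, x))"
      using f by (simp add: distr_distr comp_def)
  qed
  finally show ?thesis .
qed

lemma distr_kernel_product_fst:
  assumes \<kappa>: "\<kappa> \<in> M \<rightarrow>\<^sub>M prob_algebra borel"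
  shows "distr (kernel_product M \<kappa>) M fst = M"
proof -
  have "distr (kernel_product M \<kappa>) M fst = M \<bind> (\<lambda>\<omega>. distr (\<kappa> \<omega>) M (\<lambda>x. \<omega>))"
    using distr_kernel_product[OF \<kappa> measurable_fst] by simp
  also have "\<dots> = M \<bind> return M"
    by (intro bind_cong refl prob_space.distr_const prob_algebraD(1)[OF measurable_space[OF \<kappa>]])
  also have "\<dots> = M" by (rule bind_return'') simp
  finally show ?thesis .
qed

lemma kernel_product_cong_AE:
  assumes "\<kappa> \<in> M \<rightarrow>\<^sub>M prob_algebra borel" "\<kappa>' \<in> M \<rightarrow>\<^sub>M prob_algebra borel"
    and "AE \<omega> in M. \<kappa> \<omega> = \<kappa>' \<omega>"
  shows "kernel_product M \<kappa> = kernel_product M \<kappa>'"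
  unfolding kernel_product_def
proof (rule bind_cong_AE'[OF _ kernel_product_kernel_measurable kernel_product_kernel_measurable])
  show "M \<in> space (prob_algebra M)" by (simp add: space_prob_algebra prob_space_axioms)
  show "AE \<omega> in M. distr (\<kappa> \<omega>) (M \<Otimes>\<^sub>M borel) (Pair \<omega>) = distr (\<kappa>' \<omega>) (M \<Otimes>\<^sub>M borel) (Pair \<omega>)"
    using assms(3) by eventually_elim simp
qed (use assms in auto)

end

section \<open>Skew product invariance and versions of the limit\<close>

context markovian_rds_periodic_measure
begin

text \<open>By \<open>inv\<close> the image of the fibre over \<open>\<omega>\<close> is the fibre
  of \<open>\<kappa>'\<close> over \<open>\<theta> u \<omega>\<close>. The integrand then depends on
  the sample point only through \<open>\<theta> u \<omega>\<close>, and preservation of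
  \<open>P\<close> absorbs the shift.\<close>

lemma distr_kernel_product_skew:
  assumes u: "0 \<le> u"
    and \<kappa>: "\<kappa> \<in> P \<rightarrow>\<^sub>M prob_algebra borel" and \<kappa>': "\<kappa>' \<in> P \<rightarrow>\<^sub>M prob_algebra borel"
    and inv: "AE \<omega> in P. distr (\<kappa> \<omega>) borel (\<Phi> u \<omega>) = \<kappa>' (\<theta> u \<omega>)"
  shows "distr (kernel_product P \<kappa>) (P \<Otimes>\<^sub>M borel) (skew_product \<theta> \<Phi> u) = kernel_product P \<kappa>'"
proof -
  have P: "P \<in> space (prob_algebra P)" by (simp add: space_prob_algebra prob_space_axioms)
  have \<Phi>m: "(\<lambda>p. \<Phi> u (fst p) (snd p)) \<in> P \<Otimes>\<^sub>M borel \<rightarrow>\<^sub>M borel"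
    using Phi_P_measurable[OF u] by (simp add: case_prod_unfold)
  have \<theta>m: "(\<lambda>p. \<theta> u (fst p)) \<in> P \<Otimes>\<^sub>M borel \<rightarrow>\<^sub>M P"
    by (rule measurable_compose[OF measurable_fst theta_measurable])
  have skew: "skew_product \<theta> \<Phi> u \<in> P \<Otimes>\<^sub>M borel \<rightarrow>\<^sub>M P \<Otimes>\<^sub>M borel"
    unfolding skew_product_def case_prod_unfold by (rule measurable_Pair[OF \<theta>m \<Phi>m])
  have "distr (kernel_product P \<kappa>) (P \<Otimes>\<^sub>M borel) (skew_product \<theta> \<Phi> u)
      = P \<bind> (\<lambda>\<omega>. distr (\<kappa> \<omega>) (P \<Otimes>\<^sub>M borel) (\<lambda>x. skew_product \<theta> \<Phi> u (\<omega>, x)))"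
    by (rule distr_kernel_product[OF \<kappa> skew])
  also have "\<dots> = P \<bind> (\<lambda>\<omega>. distr (\<kappa>' (\<theta> u \<omega>)) (P \<Otimes>\<^sub>M borel) (Pair (\<theta> u \<omega>)))"
  proof (rule bind_cong_AE'[OF P])
    show "(\<lambda>\<omega>. distr (\<kappa> \<omega>) (P \<Otimes>\<^sub>M borel) (\<lambda>x. skew_product \<theta> \<Phi> u (\<omega>, x))) \<in> P \<rightarrow>\<^sub>M prob_algebra (P \<Otimes>\<^sub>M borel)"
      using \<kappa> skew by (intro measurable_distr_prob_space2) (auto simp: case_prod_unfold)
    show "(\<lambda>\<omega>. distr (\<kappa>' (\<theta> u \<omega>)) (P \<Otimes>\<^sub>M borel) (Pair (\<theta> u \<omega>))) \<in> P \<rightarrow>\<^sub>M prob_algebra (P \<Otimes>\<^sub>M borel)"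
      by (rule measurable_compose[OF theta_measurable kernel_product_kernel_measurable[OF \<kappa>']])
    show "AE \<omega> in P. distr (\<kappa> \<omega>) (P \<Otimes>\<^sub>M borel) (\<lambda>x. skew_product \<theta> \<Phi> u (\<omega>, x))
      = distr (\<kappa>' (\<theta> u \<omega>)) (P \<Otimes>\<^sub>M borel) (Pair (\<theta> u \<omega>))"
      using inv AE_space
    proof eventually_elim
      case (elim \<omega>)
      have "\<Phi> u \<omega> \<in> \<kappa> \<omega> \<rightarrow>\<^sub>M borel"
        using Phi_section_measurable[OF u elim(2)] prob_algebraD(2)[OF measurable_space[OF \<kappa> elim(2)]]
        by (simp cong: measurable_cong_sets)
      then have "distr (distr (\<kappa> \<omega>) borel (\<Phi> u \<omega>)) (P \<Otimes>\<^sub>M borel) (Pair (\<theta> u \<omega>))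
          = distr (\<kappa> \<omega>) (P \<Otimes>\<^sub>M borel) (Pair (\<theta> u \<omega>) \<circ> \<Phi> u \<omega>)"
        by (intro distr_distr measurable_Pair1' theta_space elim)
      then show ?case unfolding elim(1) by (simp add: skew_product_def comp_def)
    qed
  qed
  also have "\<dots> = distr P P (\<theta> u) \<bind> (\<lambda>\<omega>. distr (\<kappa>' \<omega>) (P \<Otimes>\<^sub>M borel) (Pair \<omega>))"
    by (rule bind_distr[symmetric, OF theta_measurable
          measurable_prob_algebraD[OF kernel_product_kernel_measurable[OF \<kappa>']] not_empty])
  finally show ?thesis by (simp add: theta_preserving kernel_product_def)
qed

text \<open>Adding \<open>m\<close> periods to \<open>s\<close> drops the first \<open>m\<close>
  terms of the sequence. With \<open>m\<close> from \<open>nonneg_shift\<close> the remaining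
  running times are nonnegative, as the results on pull-backs require.\<close>

lemma pullback_limit_version_iff:
  "pullback_limit_version P \<theta> \<Phi> \<tau> \<rho> s \<kappa> \<longleftrightarrow> \<kappa> \<in> P \<rightarrow>\<^sub>M prob_algebra borel \<and>
    (AE \<omega> in P. weakly_converges_to (\<lambda>n. pullback (real n * \<tau> + (real m * \<tau> + s)) \<omega>) (\<kappa> \<omega>))"
proof -
  have "weakly_converges_to (\<lambda>n. pullback (real n * \<tau> + (real m * \<tau> + s)) \<omega>) L
      \<longleftrightarrow> weakly_converges_to (pullback_measure \<theta> \<Phi> \<tau> \<rho> s \<omega>) L" for \<omega> L
    using weakly_converges_to_ignore_initial_segment[of "pullback_measure \<theta> \<Phi> \<tau> \<rho> s \<omega>" m L]
    by (simp add: pullback_measure_eq distrib_right add.assoc)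
  then show ?thesis unfolding pullback_limit_version_def by simp
qed

lemma pullback_limit_version_unique:
  assumes "pullback_limit_version P \<theta> \<Phi> \<tau> \<rho> s \<kappa>" "pullback_limit_version P \<theta> \<Phi> \<tau> \<rho> s \<kappa>'"
  shows "AE \<omega> in P. \<kappa> \<omega> = \<kappa>' \<omega>"
proof -
  have m: "\<kappa> \<in> P \<rightarrow>\<^sub>M prob_algebra borel" "\<kappa>' \<in> P \<rightarrow>\<^sub>M prob_algebra borel"
    and lim: "AE \<omega> in P. weakly_converges_to (pullback_measure \<theta> \<Phi> \<tau> \<rho> s \<omega>) (\<kappa> \<omega>)"
      "AE \<omega> in P. weakly_converges_to (pullback_measure \<theta> \<Phi> \<tau> \<rho> s \<omega>) (\<kappa>' \<omega>)"
    using assms by (auto simp: pullback_limit_version_def)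
  from lim AE_space show ?thesis
  proof eventually_elim
    case (elim \<omega>)
    then show ?case
      using prob_algebraD[OF measurable_space[OF m(1) elim(3)]] prob_algebraD[OF measurable_space[OF m(2) elim(3)]]
      by (intro weakly_converges_to_unique[OF elim(1,2)]) (auto intro: prob_space.finite_measure)
  qed
qed

lemma nonneg_shift: obtains m :: nat where "0 \<le> real m * \<tau> + s"
proof -
  obtain m :: nat where "- s < real m * \<tau>" using reals_Archimedean3[OF tau_pos] by blast
  then show ?thesis by (intro that[of m]) simp
qed

lemma pullback_limit_version_exists: "\<exists>\<kappa>. pullback_limit_version P \<theta> \<Phi> \<tau> \<rho> s \<kappa>"
proof -
  obtain m :: nat where m: "0 \<le> real m * \<tau> + s" by (rule nonneg_shift)
  obtain \<A> :: "'x set set" where \<A>: "countable \<A>" "algebra UNIV \<A>" "sets borel = sigma_sets UNIV \<A>"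
      "\<And>W. open W \<Longrightarrow> \<exists>I. range I \<subseteq> \<A> \<and> incseq I \<and> W = (\<Union>n::nat. I n)"
    by (rule countable_generating_algebra) blast
  obtain \<kappa> where "\<kappa> \<in> P \<rightarrow>\<^sub>M prob_algebra borel"
    "AE \<omega> in P. weakly_converges_to (\<lambda>n. pullback (real n * \<tau> + (real m * \<tau> + s)) \<omega>) (\<kappa> \<omega>)"
    by (rule pullback_limit_exists[OF m \<A>]) blast
  then show ?thesis unfolding pullback_limit_version_iff[of s _ m] by blast
qed

text \<open>The versions at different times are chosen independently of each other, so periodicity
  and invariance of the fibres hold only almost surely. The product measures do not see null sets,
  hence satisfy both exactly.\<close>

lemma product_periodic_measure_pullback_limit:
  assumes \<mu>: "\<And>s. pullback_limit_version P \<theta> \<Phi> \<tau> \<rho> s (\<mu> s)"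
  shows "product_periodic_measure P \<theta> \<Phi> \<tau> (\<lambda>s. kernel_product P (\<mu> s))"
proof -
  have m: "\<mu> s \<in> P \<rightarrow>\<^sub>M prob_algebra borel" for s
    using \<mu> by (simp add: pullback_limit_version_def)
  have "kernel_product P (\<mu> (\<tau> + s)) = kernel_product P (\<mu> s)" for s
  proof (rule kernel_product_cong_AE[OF m m])
    \<comment> \<open>The sequence for \<open>\<tau> + s\<close> is the sequence for
      \<open>s\<close> without its first term, so both have the same limit.\<close>
    have "pullback_limit_version P \<theta> \<Phi> \<tau> \<rho> s (\<mu> (\<tau> + s))"
      using \<mu>[of "\<tau> + s"] pullback_limit_version_iff[of "\<tau> + s" "\<mu> (\<tau> + s)" 0]
        pullback_limit_version_iff[of s "\<mu> (\<tau> + s)" 1] by simp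
    then show "AE \<omega> in P. \<mu> (\<tau> + s) \<omega> = \<mu> s \<omega>"
      using \<mu> by (rule pullback_limit_version_unique)
  qed
  moreover have "distr (kernel_product P (\<mu> s)) (P \<Otimes>\<^sub>M borel) (skew_product \<theta> \<Phi> t) = kernel_product P (\<mu> (t + s))"
    if t: "0 \<le> t" for s t
  proof (rule distr_kernel_product_skew[OF t m m])
    \<comment> \<open>As \<open>t \<ge> 0\<close>, the same number of periods serves for
      \<open>s\<close> and for \<open>t + s\<close>.\<close>
    obtain k :: nat where k: "0 \<le> real k * \<tau> + s" by (rule nonneg_shift)
    have 1: "AE \<omega> in P. weakly_converges_to (\<lambda>n. pullback (real n * \<tau> + (real k * \<tau> + s)) \<omega>) (\<mu> s \<omega>)"
      using \<mu>[of s] unfolding pullback_limit_version_iff[of s _ k] by blast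
    have "AE \<omega> in P. weakly_converges_to (\<lambda>n. pullback (real n * \<tau> + (real k * \<tau> + (t + s))) \<omega>) (\<mu> (t + s) \<omega>)"
      using \<mu>[of "t + s"] unfolding pullback_limit_version_iff[of "t + s" _ k] by blast
    then have 2: "AE \<omega> in P. weakly_converges_to (\<lambda>n. pullback (real n * \<tau> + (t + (real k * \<tau> + s))) \<omega>) (\<mu> (t + s) \<omega>)"
      by (simp add: add.left_commute)
    show "AE \<omega> in P. distr (\<mu> s \<omega>) borel (\<Phi> t \<omega>) = \<mu> (t + s) (\<theta> t \<omega>)"
      by (rule pullback_limit_invariant[OF k t m 1 m 2])
  qed
  ultimately show ?thesis
    unfolding product_periodic_measure_def
    using tau_pos kernel_product_prob_algebra[OF m] distr_kernel_product_fst[OF m] by blast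
qed

lemma pullback_limit_version_mean:
  assumes "pullback_limit_version P \<theta> \<Phi> \<tau> \<rho> s \<kappa>" and B: "B \<in> sets borel"
  shows "(\<integral>\<omega>. measure (\<kappa> \<omega>) B \<partial>P) = measure (\<rho> s) B"
proof -
  obtain k :: nat where k: "0 \<le> real k * \<tau> + s" by (rule nonneg_shift)
  show ?thesis
    using assms(1) pullback_limit_mean[OF k _ _ B, of \<kappa>]
    unfolding pullback_limit_version_iff[of s _ k] by (simp add: rho_periodic_nat)
qed

end

theorem theorem7p1:
  fixes P :: "'w measure"
    and \<theta> :: "real \<Rightarrow> 'w \<Rightarrow> 'w"
    and \<F> :: "real \<Rightarrow> real \<Rightarrow> 'w measure"
    and \<Phi> :: "real \<Rightarrow> 'w \<Rightarrow> 'x::polish_space \<Rightarrow> 'x"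
    and \<tau> :: real
    and \<rho> :: "real \<Rightarrow> 'x measure"
  assumes "markovian_random_dynamical_system P \<theta> \<F> \<Phi>"
    and "state_periodic_measure P \<Phi> \<tau> \<rho>"
  shows "(\<forall>s. \<exists>\<kappa>. pullback_limit_version P \<theta> \<Phi> \<tau> \<rho> s \<kappa>) \<and>
    (\<forall>\<mu>\<omega> :: real \<Rightarrow> 'w \<Rightarrow> 'x measure.
       (\<forall>s. pullback_limit_version P \<theta> \<Phi> \<tau> \<rho> s (\<mu>\<omega> s)) \<longrightarrow>
         product_periodic_measure P \<theta> \<Phi> \<tau> (\<lambda>s. kernel_product P (\<mu>\<omega> s)) \<and>
         (\<forall>s. \<forall>B\<in>sets borel. (\<integral>\<omega>. measure (\<mu>\<omega> s \<omega>) B \<partial>P) = measure (\<rho> s) B))"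
proof -
  interpret markovian_random_dynamical_system P \<theta> \<F> \<Phi> by fact
  interpret markovian_rds_periodic_measure P \<theta> \<F> \<Phi> \<tau> \<rho> by unfold_locales fact
  show ?thesis
    using pullback_limit_version_exists product_periodic_measure_pullback_limit pullback_limit_version_mean
    by blast
qed

end
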